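(* Let $(H,R)$ be a quasitriangular quasi-Hopf algebra over a field $k$, with reassociator $\Phi$, antipode $S$ and distinguished elements $\alpha,\beta\in H$, and let $u=S(R^2x^2\beta S(x^3))\alpha R^1x^1\in H$, where $R=R^1\otimes R^2$ and $\Phi^{-1}=x^1\otimes x^2\otimes x^3$. Then $(H,R)$ is ribbon if and only if there exists a central element $\nu\in H$ such that $$\Delta(\nu)=(\nu\otimes\nu)(R_{21}R)^{-1},\qquad S(\nu)=\nu,\qquad \nu^2=uS(u).$$
   Context: All vector spaces and algebras are over a field $k$, $\otimes=\otimes_k$, and summation over tensor components is implicit. A quasi-bialgebra $(H,\Delta,\varepsilon,\Phi)$ consists of an associative unital algebra $H$, algebra maps $\Delta:H\to H\otimes H$, $\Delta(h)=h_1\otimes h_2$, and $\varepsilon:H\to k$, and an invertible $\Phi=X^1\otimes X^2\otimes X^3\in H^{\otimes 3}$ with inverse $\Phi^{-1}=x^1\otimes x^2\otimes x^3$, such that $(\mathrm{id}\otimes\Delta)(\Delta(h))=\Phi(\Delta\otimes\mathrm{id})(\Delta(h))\Phi^{-1}$, $(\mathrm{id}\otimes\varepsilon)\Delta(h)=h=(\varepsilon\otimes\mathrm{id})\Delta(h)$ for all $h\in H$, $(1\otimes\Phi)(\mathrm{id}\otimes\Delta\otimes\mathrm{id})(\Phi)(\Phi\otimes1)=(\mathrm{id}\otimes\mathrm{id}\otimes\Delta)(\Phi)(\Delta\otimes\mathrm{id}\otimes\mathrm{id})(\Phi)$, and $(\mathrm{id}\otimes\varepsilon\otimes\mathrm{id})(\Phi)=1\otimes1$.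 It is a quasi-Hopf algebra if there are an algebra anti-morphism $S:H\to H$ and $\alpha,\beta\in H$ with $S(h_1)\alpha h_2=\varepsilon(h)\alpha$, $h_1\beta S(h_2)=\varepsilon(h)\beta$ for all $h\in H$, $X^1\beta S(X^2)\alpha X^3=1$ and $S(x^1)\alpha x^2\beta S(x^3)=1$. Bijectivity of $S$ is not part of the definition, but is implicitly understood whenever $S^{-1}$ is used. It is quasitriangular, denoted $(H,R)$, if there is an invertible $R=R^1\otimes R^2\in H\otimes H$ with (writing $r^1\otimes r^2$ for a second copy of $R$, and $Y^1\otimes Y^2\otimes Y^3$, $y^1\otimes y^2\otimes y^3$ for second copies of $\Phi$, $\Phi^{-1}$) $\Delta^{\rm cop}(h)R=R\Delta(h)$ for all $h$, where $\Delta^{\rm cop}(h)=h_2\otimes h_1$; $(\Delta\otimes\mathrm{id})(R)=X^2R^1x^1Y^1\otimes X^3x^3r^1Y^2\otimes X^1R^2x^2r^2Y^3$; $(\mathrm{id}\otimes\Delta)(R)=x^3R^1X^2r^1y^1\otimes x^1X^1r^2y^2\otimes x^2R^2X^3y^3$; and $\varepsilon(R^1)R^2=\varepsilon(R^2)R^1=1$. Write $R_{21}=R^2\otimes R^1$. A quasitriangular quasi-Hopf algebra $(H,R)$ is called ribbon if there exists an invertible central element $\nu\in H$ such that $\Delta(\nu)=(\nu\otimes\nu)(R_{21}R)^{-1}$ and $S(\nu)=\nu$. *)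

theory Defs
  imports Complex_Main "HOL-Library.Poly_Mapping"
begin

text \<open>
  An algebra \<open>H\<close> over the field \<open>'k\<close> is a type \<open>'h\<close> of class \<open>ring_1\<close> with a scalar multiplication
  \<open>scale\<close>.  The tensor power \<open>H\<^sup>\<otimes>\<^sup>n\<close> is the vector space freely generated by the words of length \<open>n\<close>
  over \<open>H\<close> (a word \<open>[a\<^sub>1, \<dots>, a\<^sub>n]\<close> stands for the pure tensor \<open>a\<^sub>1 \<otimes> \<dots> \<otimes> a\<^sub>n\<close>), modulo multilinearity
  in the letters.  The relations depend on \<open>scale\<close>, so tensors are equivalence classes and not
  elements of a quotient type.
\<close>

type_synonym ('k, 'h) tensor = "('h list \<Rightarrow>\<^sub>0 'k) set"

section \<open>Free vector spaces and implicit summation\<close>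

definition fscale :: "'k::field \<Rightarrow> ('w \<Rightarrow>\<^sub>0 'k) \<Rightarrow> ('w \<Rightarrow>\<^sub>0 'k)" where
  "fscale c p = Poly_Mapping.map ((*) c) p"

abbreviation word :: "'w \<Rightarrow> ('w \<Rightarrow>\<^sub>0 'k::field)" where
  "word w \<equiv> Poly_Mapping.single w 1"

text \<open>Linear extension of \<open>g\<close> from the generators to the free vector space; \<open>sc\<close> is the scalar
  multiplication of the target.\<close>

definition lin_ext :: "('k::field \<Rightarrow> 'v \<Rightarrow> 'v) \<Rightarrow> ('w \<Rightarrow> 'v) \<Rightarrow> ('w \<Rightarrow>\<^sub>0 'k) \<Rightarrow> 'v::comm_monoid_add" where
  "lin_ext sc g p = (\<Sum>w\<in>Poly_Mapping.keys p. sc (Poly_Mapping.lookup p w) (g w))"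

definition rep :: "'p set \<Rightarrow> 'p" where
  "rep A = (SOME p. p \<in> A)"

text \<open>The implicit summation over tensor components: \<open>sweedler sc A g\<close> chooses a presentation of the
  tensor \<open>A\<close> as a linear combination of words and sums \<open>g\<close> over it.  Whenever \<open>g\<close> is multilinear
  in the letters the result does not depend on the presentation, see \<open>sweedler_wd\<close> below.\<close>

definition sweedler ::
  "('k::field \<Rightarrow> 'v \<Rightarrow> 'v) \<Rightarrow> ('k, 'h) tensor \<Rightarrow> ('h list \<Rightarrow> 'v) \<Rightarrow> 'v::comm_monoid_add" where
  "sweedler sc A g = lin_ext sc g (rep A)"

definition fconcat :: "('h list \<Rightarrow>\<^sub>0 'k::field) \<Rightarrow> ('h list \<Rightarrow>\<^sub>0 'k) \<Rightarrow> ('h list \<Rightarrow>\<^sub>0 'k)" where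
  "fconcat p q = lin_ext fscale (\<lambda>v. lin_ext fscale (\<lambda>w. word (v @ w)) q) p"

definition free_words :: "nat \<Rightarrow> ('h list \<Rightarrow>\<^sub>0 'k::field) set" where
  "free_words n = {p. \<forall>w\<in>Poly_Mapping.keys p. length w = n}"

section \<open>Tensor powers of an algebra\<close>

locale k_algebra = vector_space scale
  for scale :: "'k::field \<Rightarrow> 'h::ring_1 \<Rightarrow> 'h" (infixr \<open>*s\<close> 75) +
  assumes scale_mult_left: "(c *s a) * b = c *s (a * b)"
    and scale_mult_right: "a * (c *s b) = c *s (a * b)"
begin

definition multilinear_relations :: "nat \<Rightarrow> ('h list \<Rightarrow>\<^sub>0 'k) set" where
  "multilinear_relations n =
     {word (v @ (a + b) # w) - word (v @ a # w) - word (v @ b # w) | v a b w.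
        Suc (length v + length w) = n} \<union>
     {word (v @ (c *s a) # w) - fscale c (word (v @ a # w)) | v c a w.
        Suc (length v + length w) = n}"

definition tensor_rel :: "nat \<Rightarrow> (('h list \<Rightarrow>\<^sub>0 'k) \<times> ('h list \<Rightarrow>\<^sub>0 'k)) set" where
  "tensor_rel n = {(p, q). p \<in> free_words n \<and> q \<in> free_words n \<and>
     p - q \<in> module.span fscale (multilinear_relations n)}"

definition tensor_power :: "nat \<Rightarrow> ('k, 'h) tensor set" where
  "tensor_power n = free_words n // tensor_rel n"

definition tensor_class :: "nat \<Rightarrow> ('h list \<Rightarrow>\<^sub>0 'k) \<Rightarrow> ('k, 'h) tensor" where
  "tensor_class n p = tensor_rel n `` {p}"

definition pure :: "'h list \<Rightarrow> ('k, 'h) tensor" where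
  "pure w = tensor_class (length w) (word w)"

definition tensor_add :: "nat \<Rightarrow> ('k, 'h) tensor \<Rightarrow> ('k, 'h) tensor \<Rightarrow> ('k, 'h) tensor" where
  "tensor_add n A B = tensor_class n (rep A + rep B)"

definition tensor_scale :: "nat \<Rightarrow> 'k \<Rightarrow> ('k, 'h) tensor \<Rightarrow> ('k, 'h) tensor" where
  "tensor_scale n c A = tensor_class n (fscale c (rep A))"

definition tensor_one :: "nat \<Rightarrow> ('k, 'h) tensor" where
  "tensor_one n = pure (replicate n 1)"

definition tensor_mult :: "nat \<Rightarrow> ('k, 'h) tensor \<Rightarrow> ('k, 'h) tensor \<Rightarrow> ('k, 'h) tensor" where
  "tensor_mult n A B = tensor_class n
     (sweedler fscale A (\<lambda>v. sweedler fscale B (\<lambda>w. word (map2 (*) v w))))"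

abbreviation tensor_mult_syntax (\<open>(_ \<odot>\<^bsub>_\<^esub>/ _)\<close> [70, 0, 71] 70) where
  "A \<odot>\<^bsub>n\<^esub> B \<equiv> tensor_mult n A B"

definition tensor_invertible :: "nat \<Rightarrow> ('k, 'h) tensor \<Rightarrow> bool" where
  "tensor_invertible n A \<longleftrightarrow>
     (\<exists>B\<in>tensor_power n. A \<odot>\<^bsub>n\<^esub> B = tensor_one n \<and> B \<odot>\<^bsub>n\<^esub> A = tensor_one n)"

definition tensor_inv :: "nat \<Rightarrow> ('k, 'h) tensor \<Rightarrow> ('k, 'h) tensor" where
  "tensor_inv n A =
     (THE B. B \<in> tensor_power n \<and> A \<odot>\<^bsub>n\<^esub> B = tensor_one n \<and> B \<odot>\<^bsub>n\<^esub> A = tensor_one n)"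

definition tensor_flip :: "('k, 'h) tensor \<Rightarrow> ('k, 'h) tensor" where
  "tensor_flip A = tensor_class 2 (sweedler fscale A (\<lambda>w. word [w ! 1, w ! 0]))"

definition incl :: "'h \<Rightarrow> ('k, 'h) tensor" where
  "incl a = pure [a]"

text \<open>\<open>tensor_outer n A B\<close> is \<open>A \<otimes> B\<close>, with \<open>n\<close> the sum of the degrees of \<open>A\<close> and \<open>B\<close>.\<close>

definition tensor_outer :: "nat \<Rightarrow> ('k, 'h) tensor \<Rightarrow> ('k, 'h) tensor \<Rightarrow> ('k, 'h) tensor" where
  "tensor_outer n A B = tensor_class n (fconcat (rep A) (rep B))"

text \<open>\<open>tensor_map m [f\<^sub>1, \<dots>, f\<^sub>n]\<close> is \<open>f\<^sub>1 \<otimes> \<dots> \<otimes> f\<^sub>n : H\<^sup>\<otimes>\<^sup>n \<rightarrow> H\<^sup>\<otimes>\<^sup>m\<close>, where \<open>f\<^sub>i : H \<rightarrow> H\<^sup>\<otimes>\<^sup>m\<^sup>i\<close>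
  is linear and \<open>m = m\<^sub>1 + \<dots> + m\<^sub>n\<close>; the identity of \<open>H\<close> enters as \<open>incl : H \<rightarrow> H\<^sup>\<otimes>\<^sup>1\<close>.\<close>

definition tensor_map ::
  "nat \<Rightarrow> ('h \<Rightarrow> ('k, 'h) tensor) list \<Rightarrow> ('k, 'h) tensor \<Rightarrow> ('k, 'h) tensor" where
  "tensor_map m fs A = tensor_class m
     (sweedler fscale A (\<lambda>w. foldr fconcat (map2 (\<lambda>f a. rep (f a)) fs w) (word [])))"

text \<open>Implicit summation over tensors of degree 2 and 3, with values in \<open>H\<close> (\<open>hsum\<close>) or in formal
  sums of words (\<open>wsum\<close>).\<close>

abbreviation hsum2 :: "('k, 'h) tensor \<Rightarrow> ('h \<Rightarrow> 'h \<Rightarrow> 'h) \<Rightarrow> 'h" where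
  "hsum2 A g \<equiv> sweedler scale A (\<lambda>w. g (w ! 0) (w ! 1))"

abbreviation hsum3 :: "('k, 'h) tensor \<Rightarrow> ('h \<Rightarrow> 'h \<Rightarrow> 'h \<Rightarrow> 'h) \<Rightarrow> 'h" where
  "hsum3 A g \<equiv> sweedler scale A (\<lambda>w. g (w ! 0) (w ! 1) (w ! 2))"

abbreviation wsum2 ::
  "('k, 'h) tensor \<Rightarrow> ('h \<Rightarrow> 'h \<Rightarrow> ('h list \<Rightarrow>\<^sub>0 'k)) \<Rightarrow> ('h list \<Rightarrow>\<^sub>0 'k)" where
  "wsum2 A g \<equiv> sweedler fscale A (\<lambda>w. g (w ! 0) (w ! 1))"

abbreviation wsum3 ::
  "('k, 'h) tensor \<Rightarrow> ('h \<Rightarrow> 'h \<Rightarrow> 'h \<Rightarrow> ('h list \<Rightarrow>\<^sub>0 'k)) \<Rightarrow> ('h list \<Rightarrow>\<^sub>0 'k)" where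
  "wsum3 A g \<equiv> sweedler fscale A (\<lambda>w. g (w ! 0) (w ! 1) (w ! 2))"

text \<open>The element \<open>u = S(R\<^sup>2x\<^sup>2\<beta>S(x\<^sup>3))\<alpha>R\<^sup>1x\<^sup>1\<close>, with \<open>x\<^sup>1 \<otimes> x\<^sup>2 \<otimes> x\<^sup>3 = \<Phi>\<^sup>-\<^sup>1\<close>.\<close>

definition drinfeld_element ::
  "('k, 'h) tensor \<Rightarrow> ('h \<Rightarrow> 'h) \<Rightarrow> 'h \<Rightarrow> 'h \<Rightarrow> ('k, 'h) tensor \<Rightarrow> 'h" where
  "drinfeld_element \<Phi> S \<alpha> \<beta> R =
     hsum2 R (\<lambda>R1 R2. hsum3 (tensor_inv 3 \<Phi>) (\<lambda>x1 x2 x3.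
       S (R2 * x2 * \<beta> * S x3) * \<alpha> * R1 * x1))"

end

section \<open>Independence of implicit summation of the presentation\<close>

lemma lookup_fscale [simp]: "Poly_Mapping.lookup (fscale c p) w = c * Poly_Mapping.lookup p w"
  by (simp add: fscale_def Poly_Mapping.map.rep_eq when_def)

lemma vector_space_fscale: "vector_space fscale"
  by unfold_locales (auto intro!: poly_mapping_eqI simp: lookup_add algebra_simps)

lemma lin_ext_superset:
  assumes "vector_space sc" "finite K" "Poly_Mapping.keys p \<subseteq> K"
  shows "lin_ext sc g p = (\<Sum>w\<in>K. sc (Poly_Mapping.lookup p w) (g w))"
proof -
  interpret vector_space sc by fact
  show ?thesis
    unfolding lin_ext_def using assms(2,3)
    by (intro sum.mono_neutral_left) (auto simp: in_keys_iff)
qed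

lemma linear_lin_ext:
  assumes "vector_space sc"
  shows "Vector_Spaces.linear fscale sc (lin_ext sc g)"
proof -
  interpret V: vector_space sc by fact
  interpret F: vector_space "fscale :: 'a \<Rightarrow> ('c \<Rightarrow>\<^sub>0 'a) \<Rightarrow> _" by (rule vector_space_fscale)
  show ?thesis
  proof unfold_locales
    fix p q :: "'c \<Rightarrow>\<^sub>0 'a" and c
    let ?K = "Poly_Mapping.keys p \<union> Poly_Mapping.keys q"
    have *: "finite ?K" by simp
    show "lin_ext sc g (p + q) = lin_ext sc g p + lin_ext sc g q"
      using Poly_Mapping.keys_add[of p q]
      by (simp add: lin_ext_superset[OF assms *] lookup_add V.scale_left_distrib sum.distrib)
    have "Poly_Mapping.keys (fscale c p) \<subseteq> Poly_Mapping.keys p"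
      by (auto simp: in_keys_iff)
    from lin_ext_superset[OF assms finite_keys this]
    show "lin_ext sc g (fscale c p) = sc c (lin_ext sc g p)"
      by (simp add: lin_ext_def V.scale_sum_right)
  qed
qed

lemma (in k_algebra) sweedler_wd:
  assumes sc: "vector_space sc"
    and add: "\<And>v a b w. Suc (length v + length w) = n \<Longrightarrow>
      g (v @ (a + b) # w) = g (v @ a # w) + g (v @ b # w)"
    and scl: "\<And>v c a w. Suc (length v + length w) = n \<Longrightarrow> g (v @ (c *s a) # w) = sc c (g (v @ a # w))"
    and p: "p \<in> free_words n"
  shows "sweedler sc (tensor_class n p) g = lin_ext sc g p"
proof -
  interpret V: vector_space sc by fact
  interpret F: vector_space "fscale :: 'k \<Rightarrow> ('h list \<Rightarrow>\<^sub>0 'k) \<Rightarrow> _" by (rule vector_space_fscale)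
  interpret L: Vector_Spaces.linear fscale sc "lin_ext sc g" by (rule linear_lin_ext[OF sc])
  have word: "lin_ext sc g (word w) = g w" for w
    by (simp add: lin_ext_def)
  have zero: "lin_ext sc g r = 0" if "r \<in> F.span (multilinear_relations n)" for r
    using that
  proof (induction rule: F.span_induct_alt)
    case base
    then show ?case by (simp add: L.zero)
  next
    case (step c x y)
    then have "lin_ext sc g x = 0"
      by (auto simp: multilinear_relations_def L.diff L.scale word add scl)
    with step show ?case by (simp add: L.add L.scale)
  qed
  have "p \<in> tensor_class n p"
    using p by (simp add: tensor_class_def tensor_rel_def F.span_zero)
  then have "rep (tensor_class n p) \<in> tensor_class n p"
    unfolding rep_def by (rule someI)
  then have "lin_ext sc g (p - rep (tensor_class n p)) = 0"
    by (intro zero) (unfold tensor_class_def tensor_rel_def, blast)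
  then show ?thesis
    by (simp add: sweedler_def L.diff)
qed

section \<open>Quasi-Hopf algebras\<close>

definition central :: "'h::ring_1 \<Rightarrow> bool" where
  "central z \<longleftrightarrow> (\<forall>h. z * h = h * z)"

locale quasi_bialgebra = k_algebra scale
  for scale :: "'k::field \<Rightarrow> 'h::ring_1 \<Rightarrow> 'h" (infixr \<open>*s\<close> 75) +
  fixes \<Delta> :: "'h \<Rightarrow> ('k, 'h) tensor"
    and \<epsilon> :: "'h \<Rightarrow> 'k"
    and \<Phi> :: "('k, 'h) tensor"
  assumes comult_closed: "\<Delta> h \<in> tensor_power 2"
    and comult_add: "\<Delta> (g + h) = tensor_add 2 (\<Delta> g) (\<Delta> h)"
    and comult_scale: "\<Delta> (c *s h) = tensor_scale 2 c (\<Delta> h)"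
    and comult_mult: "\<Delta> (g * h) = \<Delta> g \<odot>\<^bsub>2\<^esub> \<Delta> h"
    and comult_one: "\<Delta> 1 = tensor_one 2"
    and counit_linear: "Vector_Spaces.linear scale (*) \<epsilon>"
    and counit_mult: "\<epsilon> (g * h) = \<epsilon> g * \<epsilon> h"
    and counit_one: "\<epsilon> 1 = 1"
    and reassociator_closed: "\<Phi> \<in> tensor_power 3"
    and reassociator_invertible: "tensor_invertible 3 \<Phi>"
    and quasi_coassoc:
      "tensor_map 3 [incl, \<Delta>] (\<Delta> h) = \<Phi> \<odot>\<^bsub>3\<^esub> tensor_map 3 [\<Delta>, incl] (\<Delta> h) \<odot>\<^bsub>3\<^esub> tensor_inv 3 \<Phi>"
    and counit_right: "hsum2 (\<Delta> h) (\<lambda>h1 h2. \<epsilon> h2 *s h1) = h"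
    and counit_left: "hsum2 (\<Delta> h) (\<lambda>h1 h2. \<epsilon> h1 *s h2) = h"
    and pentagon:
      "tensor_outer 4 (tensor_one 1) \<Phi> \<odot>\<^bsub>4\<^esub> tensor_map 4 [incl, \<Delta>, incl] \<Phi>
         \<odot>\<^bsub>4\<^esub> tensor_outer 4 \<Phi> (tensor_one 1) =
       tensor_map 4 [incl, incl, \<Delta>] \<Phi> \<odot>\<^bsub>4\<^esub> tensor_map 4 [\<Delta>, incl, incl] \<Phi>"
    and reassociator_counit:
      "tensor_class 2 (wsum3 \<Phi> (\<lambda>X1 X2 X3. fscale (\<epsilon> X2) (word [X1, X3]))) = tensor_one 2"

locale quasi_hopf_algebra = quasi_bialgebra scale \<Delta> \<epsilon> \<Phi>
  for scale :: "'k::field \<Rightarrow> 'h::ring_1 \<Rightarrow> 'h" (infixr \<open>*s\<close> 75) and \<Delta> \<epsilon> \<Phi> +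
  fixes S :: "'h \<Rightarrow> 'h"
    and \<alpha> \<beta> :: 'h
  assumes antipode_linear: "Vector_Spaces.linear scale scale S"
    and antipode_mult: "S (g * h) = S h * S g"
    and antipode_one: "S 1 = 1"
    and antipode_left: "hsum2 (\<Delta> h) (\<lambda>h1 h2. S h1 * \<alpha> * h2) = \<epsilon> h *s \<alpha>"
    and antipode_right: "hsum2 (\<Delta> h) (\<lambda>h1 h2. h1 * \<beta> * S h2) = \<epsilon> h *s \<beta>"
    and antipode_reassociator: "hsum3 \<Phi> (\<lambda>X1 X2 X3. X1 * \<beta> * S X2 * \<alpha> * X3) = 1"
    and antipode_reassociator_inv:
      "hsum3 (tensor_inv 3 \<Phi>) (\<lambda>x1 x2 x3. S x1 * \<alpha> * x2 * \<beta> * S x3) = 1"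

locale quasitriangular_quasi_hopf_algebra = quasi_hopf_algebra scale \<Delta> \<epsilon> \<Phi> S \<alpha> \<beta>
  for scale :: "'k::field \<Rightarrow> 'h::ring_1 \<Rightarrow> 'h" (infixr \<open>*s\<close> 75) and \<Delta> \<epsilon> \<Phi> S \<alpha> \<beta> +
  fixes R :: "('k, 'h) tensor"
  assumes R_closed: "R \<in> tensor_power 2"
    and R_invertible: "tensor_invertible 2 R"
    and R_intertwines: "tensor_flip (\<Delta> h) \<odot>\<^bsub>2\<^esub> R = R \<odot>\<^bsub>2\<^esub> \<Delta> h"
    and comult_id_R:
      "tensor_map 3 [\<Delta>, incl] R = tensor_class 3
         (wsum3 \<Phi> (\<lambda>X1 X2 X3. wsum2 R (\<lambda>R1 R2. wsum3 (tensor_inv 3 \<Phi>) (\<lambda>x1 x2 x3.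
          wsum2 R (\<lambda>r1 r2. wsum3 \<Phi> (\<lambda>Y1 Y2 Y3.
            word [X2 * R1 * x1 * Y1, X3 * x3 * r1 * Y2, X1 * R2 * x2 * r2 * Y3]))))))"
    and id_comult_R:
      "tensor_map 3 [incl, \<Delta>] R = tensor_class 3
         (wsum3 (tensor_inv 3 \<Phi>) (\<lambda>x1 x2 x3. wsum2 R (\<lambda>R1 R2. wsum3 \<Phi> (\<lambda>X1 X2 X3.
          wsum2 R (\<lambda>r1 r2. wsum3 (tensor_inv 3 \<Phi>) (\<lambda>y1 y2 y3.
            word [x3 * R1 * X2 * r1 * y1, x1 * X1 * r2 * y2, x2 * R2 * X3 * y3]))))))"
    and counit_R_left: "hsum2 R (\<lambda>R1 R2. \<epsilon> R1 *s R2) = 1"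
    and counit_R_right: "hsum2 R (\<lambda>R1 R2. \<epsilon> R2 *s R1) = 1"

locale ribbon_quasi_hopf_algebra = quasitriangular_quasi_hopf_algebra +
  assumes ribbon_element_exists:
    "\<exists>\<nu>. central \<nu> \<and> (\<exists>\<mu>. \<nu> * \<mu> = 1 \<and> \<mu> * \<nu> = 1) \<and>
       \<Delta> \<nu> = pure [\<nu>, \<nu>] \<odot>\<^bsub>2\<^esub> tensor_inv 2 (tensor_flip R \<odot>\<^bsub>2\<^esub> R) \<and> S \<nu> = \<nu>"

end

theory Submission
  imports Defs
begin

text \<open>
  For an \<open>H\<close>-module \<open>V\<close> let \<open>H\<close> act on \<open>V\<^sup>*\<close> through \<open>S\<close>, so that an element \<open>x\<close> with \<open>S\<^sup>2(h)x = xh\<close> is a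
  module map \<open>V \<rightarrow> V\<^sup>*\<^sup>*\<close>, \<open>\<alpha>\<close> is the evaluation \<open>V\<^sup>* \<otimes> V \<rightarrow> k\<close> and \<open>\<beta>\<close> the coevaluation. Composing the
  evaluation with the braiding gives the form \<open>m = S(R\<^sup>2)\<alpha>R\<^sup>1\<close> on \<open>V \<otimes> V\<^sup>*\<close>. Closing its leg \<open>V\<^sup>*\<close> with the
  coevaluation of \<open>V\<^sup>*\<close> produces \<open>u : V \<rightarrow> V\<^sup>*\<^sup>*\<close>; closing the leg \<open>V\<^sup>*\<close> of the corresponding form \<open>S(m)\<close> on
  \<open>V\<^sup>* \<otimes> V\<^sup>*\<^sup>*\<close> with the coevaluation of \<open>V\<close> produces a map \<open>w : V\<^sup>*\<^sup>* \<rightarrow> V\<close>. Both are module maps (\<open>drinfeld_intertwines\<close>, \<open>codrinfeld_intertwines\<close>), because they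
  are composed of module maps, and the zigzag identities, which come from the pentagon, recover the form:
  \<open>S(\<alpha>)u = m\<close> and \<open>\<alpha>w = S(m)\<close>. Hence \<open>wu\<close> is central and, with \<open>Q = R\<^sub>2\<^sub>1R\<close>, one has
  \<open>S(Q\<^sup>1)\<alpha>Q\<^sup>2 = S(R\<^sup>1)mR\<^sup>2 = S(R\<^sup>1)S(\<alpha>)S\<^sup>2(R\<^sup>2)u = S(m)u = \<alpha>wu\<close> (\<open>double_braiding_form\<close>).

  If \<open>\<nu>\<close> is a ribbon element, then \<open>Q = \<Delta>(\<nu>\<^sup>-\<^sup>1)(\<nu> \<otimes> \<nu>)\<close>, so \<open>S(Q\<^sup>1)\<alpha>Q\<^sup>2 = \<nu>\<^sup>2\<alpha>\<close>
  (\<open>ribbon_square_alpha\<close>). Central elements are determined by their product with \<open>\<alpha>\<close>, because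
  \<open>X\<^sup>1\<beta>S(X\<^sup>2)\<alpha>X\<^sup>3 = 1\<close>; therefore \<open>wu = \<nu>\<^sup>2\<close>. To pass to \<open>uw\<close>, consider \<open>p = 1 - \<nu>\<^sup>-\<^sup>2uw\<close>. It commutes with the
  image of \<open>S\<^sup>2\<close> and \<open>wp = 0\<close>, so \<open>S(m)p = 0\<close>. Since \<open>R\<close> is invertible, it can be stripped off from \<open>S(m)\<close>,
  which leaves \<open>S(\<alpha>)p = 0\<close>, and the antipode identity turns this into \<open>p = 0\<close> (\<open>drinfeld_codrinfeld\<close>).
  Now \<open>u\<close> is invertible, \<open>S\<^sup>2\<close> is conjugation by \<open>u\<close>, and \<open>S\<close> is surjective. Hence
  \<open>xS(u) = S(u)S\<^sup>2(x)\<close> for all \<open>x\<close>, and inserting \<open>S(m) = S(u)S\<^sup>2(\<alpha>)\<close> into the definition of \<open>w\<close> gives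
  \<open>w = S(u)\<close>, that is, \<open>\<nu>\<^sup>2 = uS(u)\<close> (\<open>ribbon_imp_square\<close>).

  Conversely, let \<open>\<nu>\<close> satisfy the three equations. Applying \<open>\<epsilon> \<otimes> id\<close> to the first yields \<open>\<epsilon>(\<nu>)\<nu> = \<nu>\<close>, and
  \<open>\<epsilon>(u) = 1\<close> gives \<open>\<epsilon>(\<nu>)\<^sup>2 = 1\<close>, so \<open>\<epsilon>(\<nu>) = 1\<close>. Applying \<open>a \<otimes> b \<mapsto> S(a)\<alpha>b\<close> to \<open>\<Delta>(\<nu>)\<close> shows
  that \<open>\<alpha> = \<nu>\<^sup>2t\<close> for some \<open>t\<close>, and then \<open>X\<^sup>1\<beta>S(X\<^sup>2)\<alpha>X\<^sup>3 = 1\<close> exhibits an inverse of \<open>\<nu>\<close>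
  (\<open>square_imp_invertible\<close>).

  All computations apply multilinear maps with values in \<open>H\<close> to tensors. These maps separate tensors
  (\<open>tensor_eqI\<close>), so that the algebra structure of the tensor powers, in particular the uniqueness of inverses,
  reduces to computations in \<open>H\<close>.
\<close>

section \<open>Linear extension from words\<close>

lemma lin_ext_lin_ext:
  assumes "vector_space sc"
  shows "lin_ext sc G (lin_ext fscale g p) = lin_ext sc (\<lambda>w. lin_ext sc G (g w)) p"
proof -
  interpret L: Vector_Spaces.linear fscale sc "lin_ext sc G"
    by (rule linear_lin_ext[OF assms])
  show ?thesis
    by (simp add: lin_ext_def[of fscale] lin_ext_def[of sc _ p] L.sum L.scale)
qed

lemma lin_ext_word [simp]: "vector_space sc \<Longrightarrow> lin_ext sc G (word w) = G w"
  by (simp add: lin_ext_def vector_space.vector_space_assms(4))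

lemma lin_ext_fscale_word: "lin_ext fscale word p = p"
  by (rule poly_mapping_eqI)
    (auto simp: lin_ext_def lookup_sum lookup_single when_def in_keys_iff
      if_distrib[of "\<lambda>t. _ * t"] cong: if_cong)

lemma lin_ext_cong: "(\<And>w. w \<in> Poly_Mapping.keys p \<Longrightarrow> f w = g w) \<Longrightarrow> lin_ext sc f p = lin_ext sc g p"
  by (simp add: lin_ext_def)

lemma lin_ext_fconcat:
  assumes "vector_space sc"
  shows "lin_ext sc G (fconcat p q) = lin_ext sc (\<lambda>v. lin_ext sc (\<lambda>w. G (v @ w)) q) p"
  using assms by (simp add: fconcat_def lin_ext_lin_ext)

lemma free_wordsD: "p \<in> free_words n \<Longrightarrow> w \<in> Poly_Mapping.keys p \<Longrightarrow> length w = n"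
  by (simp add: free_words_def)

lemma word_free_words [simp]: "(word w :: _ \<Rightarrow>\<^sub>0 'k::field) \<in> free_words n \<longleftrightarrow> length w = n"
  by (simp add: free_words_def)

lemma lin_ext_free_words:
  assumes "\<And>w. w \<in> Poly_Mapping.keys p \<Longrightarrow> g w \<in> free_words n"
  shows "lin_ext fscale g p \<in> free_words n"
proof -
  have "finite K \<Longrightarrow> (\<And>w. w \<in> K \<Longrightarrow> g w \<in> free_words n) \<Longrightarrow>
      (\<Sum>w\<in>K. fscale (c w) (g w)) \<in> free_words n" for K c
  proof (induction K rule: finite_induct)
    case empty
    then show ?case by (simp add: free_words_def)
  next
    case (insert x F)
    have "Poly_Mapping.keys (fscale (c x) (g x)) \<subseteq> Poly_Mapping.keys (g x)"
      by (auto simp: in_keys_iff)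
    with insert show ?case
      using Poly_Mapping.keys_add[of "fscale (c x) (g x)" "\<Sum>w\<in>F. fscale (c w) (g w)"]
      by (fastforce simp: free_words_def)
  qed
  then show ?thesis using assms by (simp add: lin_ext_def)
qed

lemma fconcat_free_words:
  "p \<in> free_words m \<Longrightarrow> q \<in> free_words n \<Longrightarrow> m + n = k \<Longrightarrow> fconcat p q \<in> free_words k"
  unfolding fconcat_def by (intro lin_ext_free_words) (auto dest: free_wordsD)

context k_algebra
begin

interpretation F: vector_space "fscale :: 'k \<Rightarrow> ('h list \<Rightarrow>\<^sub>0 'k) \<Rightarrow> _"
  by (rule vector_space_fscale)

lemma tensor_rel_equiv: "equiv (free_words n) (tensor_rel n)"
proof (rule equivI)
  show "tensor_rel n \<subseteq> free_words n \<times> free_words n"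
    by (auto simp: tensor_rel_def)
  show "refl_on (free_words n) (tensor_rel n)"
    by (auto simp: tensor_rel_def refl_on_def F.span_zero)
  show "sym (tensor_rel n)"
    unfolding sym_def tensor_rel_def by clarsimp (metis F.span_neg minus_diff_eq)
  show "trans (tensor_rel n)"
  proof (rule transI)
    fix p q r assume "(p, q) \<in> tensor_rel n" "(q, r) \<in> tensor_rel n"
    then show "(p, r) \<in> tensor_rel n"
      unfolding tensor_rel_def using F.span_add[of "p - q" _ "q - r"] by simp
  qed
qed

lemma tensor_class_closed [simp]: "p \<in> free_words n \<Longrightarrow> tensor_class n p \<in> tensor_power n"
  by (simp add: tensor_class_def tensor_power_def quotientI)

lemma
  assumes "A \<in> tensor_power n"
  shows rep_free_words: "rep A \<in> free_words n" and tensor_class_rep: "tensor_class n (rep A) = A"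
proof -
  obtain p where p: "p \<in> free_words n" "A = tensor_rel n `` {p}"
    using assms by (auto simp: tensor_power_def elim: quotientE)
  have "p \<in> A" using p by (simp add: tensor_rel_def F.span_zero)
  then have "rep A \<in> A" unfolding rep_def by (rule someI)
  then have rel: "(p, rep A) \<in> tensor_rel n" using p by simp
  then show "rep A \<in> free_words n" by (simp add: tensor_rel_def)
  show "tensor_class n (rep A) = A"
    using equiv_class_eq[OF tensor_rel_equiv rel] p by (simp add: tensor_class_def)
qed

lemma length_rep: "A \<in> tensor_power n \<Longrightarrow> w \<in> Poly_Mapping.keys (rep A) \<Longrightarrow> length w = n"
  using rep_free_words free_wordsD by blast

section \<open>Multilinear maps separate tensors\<close>

definition lin :: "('h \<Rightarrow> 'h) \<Rightarrow> bool" where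
  "lin f \<longleftrightarrow> (\<forall>a b. f (a + b) = f a + f b) \<and> (\<forall>c a. f (c *s a) = c *s f a)"

definition multilinear :: "nat \<Rightarrow> ('h list \<Rightarrow> 'h) \<Rightarrow> bool" where
  "multilinear n g \<longleftrightarrow> (\<forall>v w. Suc (length v + length w) = n \<longrightarrow> lin (\<lambda>a. g (v @ a # w)))"

abbreviation ev :: "('k, 'h) tensor \<Rightarrow> ('h list \<Rightarrow> 'h) \<Rightarrow> 'h" where
  "ev A g \<equiv> sweedler scale A g"

text \<open>The value of a multilinear map on a tensor can be computed on any representative; the defining formulas of the
  operations on tensors are evaluated through this fact.\<close>

lemma ev_class:
  assumes "p \<in> free_words n" "multilinear n g"
  shows "ev (tensor_class n p) g = lin_ext scale g p"
  using assms(2) by (intro sweedler_wd vector_space_axioms assms(1))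
    (auto simp: multilinear_def lin_def)

lemma ev_cong:
  assumes "A \<in> tensor_power n" "\<And>w. length w = n \<Longrightarrow> f w = g w"
  shows "ev A f = ev A g"
  unfolding sweedler_def using assms by (intro lin_ext_cong) (auto dest: length_rep)

lemma
  shows lin_id: "lin (\<lambda>x. x)"
    and lin_mult_const: "lin f \<Longrightarrow> lin (\<lambda>x. f x * c)"
    and lin_const_mult: "lin f \<Longrightarrow> lin (\<lambda>x. c * f x)"
    and lin_scale: "lin f \<Longrightarrow> lin (\<lambda>x. r *s f x)"
    and lin_comp: "lin g \<Longrightarrow> lin f \<Longrightarrow> lin (\<lambda>x. g (f x))"
  by (auto simp: lin_def algebra_simps scale_mult_left scale_mult_right scale_right_distrib
      scale_left_commute)

lemma lin_sum: "(\<And>i. i \<in> I \<Longrightarrow> lin (f i)) \<Longrightarrow> lin (\<lambda>x. \<Sum>i\<in>I. f i x)"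
  by (simp add: lin_def sum.distrib scale_sum_right)

lemma lin_0: "lin f \<Longrightarrow> f 0 = 0"
  unfolding lin_def by (metis scale_zero_left)

lemma lin_ev_strong:
  assumes "\<And>w. w \<in> Poly_Mapping.keys (rep A) \<Longrightarrow> lin (\<lambda>x. f x w)"
  shows "lin (\<lambda>x. ev A (f x))"
  unfolding sweedler_def lin_ext_def by (intro lin_sum lin_scale assms)

lemma lin_ev: "(\<And>w. lin (\<lambda>x. f x w)) \<Longrightarrow> lin (\<lambda>x. ev A (f x))"
  by (rule lin_ev_strong)

lemma ev_lin:
  assumes "lin f"
  shows "f (ev A g) = ev A (\<lambda>w. f (g w))"
proof -
  have "f (\<Sum>w\<in>K. h w) = (\<Sum>w\<in>K. f (h w))" if "finite K" for h and K :: "'h list set"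
    using that by (induction K rule: finite_induct) (use assms in \<open>auto simp: lin_0, simp add: lin_def\<close>)
  then show ?thesis
    using assms by (simp add: sweedler_def lin_ext_def lin_def)
qed

lemma ev_swap: "ev A (\<lambda>v. ev B (\<lambda>w. g v w)) = ev B (\<lambda>w. ev A (\<lambda>v. g v w))"
  unfolding sweedler_def lin_ext_def
  unfolding scale_sum_right scale_left_commute[of "Poly_Mapping.lookup (rep B) _"]
  by (rule sum.swap)

text \<open>If \<open>A\<close> and \<open>B\<close> have representatives whose difference lies outside the span of the multilinearity relations,
  then some linear functional \<open>\<phi>\<close> vanishes on the relations but not on the difference, and \<open>w \<mapsto> \<phi>(w)1\<close> is a
  multilinear map into \<open>H\<close> that tells \<open>A\<close> and \<open>B\<close> apart, unless \<open>H = 0\<close>. In that case every word of positive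
  length is itself in the span of the relations.\<close>

lemma tensor_eqI:
  assumes A: "A \<in> tensor_power n" and B: "B \<in> tensor_power n" and "n > 0"
    and eq: "\<And>g. multilinear n g \<Longrightarrow> ev A g = ev B g"
  shows "A = B"
proof -
  interpret FK: vector_space_pair "fscale :: 'k \<Rightarrow> ('h list \<Rightarrow>\<^sub>0 'k) \<Rightarrow> _" "(*) :: 'k \<Rightarrow> 'k \<Rightarrow> 'k"
    by unfold_locales (simp_all add: algebra_simps)
  let ?M = "multilinear_relations n"
  define x where "x = rep A - rep B"
  have "x \<in> F.span ?M"
  proof (rule ccontr)
    assume x: "x \<notin> F.span ?M"
    \<comment> \<open>A basis \<open>C\<close> of the span of the relations stays independent together with \<open>x\<close>.\<close>
    obtain C where C: "C \<subseteq> ?M" "F.independent C" "?M \<subseteq> F.span C"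
      by (rule F.maximal_independent_subset)
    have "F.span C = F.span ?M"
      using C F.span_mono F.span_minimal F.subspace_span by (metis subset_antisym)
    with x C have ind: "F.independent (insert x C)"
      by (simp add: F.independent_insert)
    have "x \<notin> C" using x C F.span_base by blast
    obtain \<phi> where \<phi>: "Vector_Spaces.linear fscale (*) \<phi>"
        "\<forall>y\<in>insert x C. \<phi> y = (if y = x then 1 else 0)"
      using FK.linear_independent_extend[OF ind, of "\<lambda>y. if y = x then 1 else 0"] by blast
    interpret \<phi>: Vector_Spaces.linear fscale "(*)" \<phi> by (rule \<phi>(1))
    have vanish: "\<phi> y = 0" if "y \<in> ?M" for y
    proof -
      have "y \<in> F.span C" using that C by blast
      then show ?thesis
      proof (induction rule: F.span_induct_alt)
        case (step c z y)
        with \<phi>(2) \<open>x \<notin> C\<close> show ?case by (auto simp: \<phi>.add \<phi>.scale)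
      qed (simp add: \<phi>.zero)
    qed
    define g where "g w = \<phi> (word w) *s (1 :: 'h)" for w
    have "multilinear n g"
      unfolding multilinear_def lin_def g_def
    proof (intro allI impI conjI)
      fix v w :: "'h list" and a b :: 'h and c :: 'k
      assume n: "Suc (length v + length w) = n"
      have "word (v @ (a + b) # w) - word (v @ a # w) - word (v @ b # w) \<in> ?M"
        using n unfolding multilinear_relations_def by blast
      from vanish[OF this]
      show "\<phi> (word (v @ (a + b) # w)) *s 1 = \<phi> (word (v @ a # w)) *s (1::'h) + \<phi> (word (v @ b # w)) *s 1"
        by (simp add: \<phi>.diff diff_eq_eq scale_left_distrib add.commute)
      have "word (v @ (c *s a) # w) - fscale c (word (v @ a # w)) \<in> ?M"
        using n unfolding multilinear_relations_def by blast
      from vanish[OF this]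
      show "\<phi> (word (v @ (c *s a) # w)) *s (1::'h) = c *s \<phi> (word (v @ a # w)) *s 1"
        by (simp add: \<phi>.diff \<phi>.scale)
    qed
    note eq[OF this]
    moreover have "lin_ext scale g p = \<phi> p *s 1" for p
    proof -
      have "lin_ext scale g p = \<phi> (lin_ext fscale word p) *s 1"
        by (simp add: lin_ext_def g_def \<phi>.sum \<phi>.scale scale_sum_left)
      also note lin_ext_fscale_word
      finally show ?thesis .
    qed
    ultimately have "\<phi> x *s (1::'h) = 0"
      by (simp add: sweedler_def x_def \<phi>.diff scale_left_diff_distrib)
    with \<phi>(2) have one: "(1::'h) = 0" by simp
    \<comment> \<open>The remaining case is the zero algebra, where all letters are \<open>0\<close>.\<close>
    have "word w \<in> F.span ?M" if "length w = n" for w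
    proof -
      from that \<open>n > 0\<close> obtain a v where w: "w = [] @ a # v" by (cases w) auto
      have "a = 0" using one by (metis mult_1 mult_zero_left)
      then have "word w = word ([] @ (0 *s a) # v) - fscale 0 (word ([] @ a # v))"
        by (intro poly_mapping_eqI) (simp add: w lookup_minus)
      also have "\<dots> \<in> ?M" using that w unfolding multilinear_relations_def by fastforce
      finally show ?thesis by (rule F.span_base)
    qed
    then have "p \<in> F.span ?M" if "p \<in> free_words n" for p
    proof -
      have "lin_ext fscale word p \<in> F.span ?M"
        unfolding lin_ext_def using that \<open>\<And>w. length w = n \<Longrightarrow> word w \<in> F.span ?M\<close>
        by (intro F.span_sum F.span_scale) (auto dest: free_wordsD)
      also note lin_ext_fscale_word
      finally show ?thesis .
    qed
    with x show False
      using A B rep_free_words F.span_diff unfolding x_def by blast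
  qed
  then have "(rep A, rep B) \<in> tensor_rel n"
    using A B by (simp add: tensor_rel_def rep_free_words x_def)
  from equiv_class_eq[OF tensor_rel_equiv this] show ?thesis
    using A B tensor_class_rep unfolding tensor_class_def by metis
qed

section \<open>The tensor powers as algebras\<close>

lemma tensor_mult_closed [simp]:
  "A \<in> tensor_power n \<Longrightarrow> B \<in> tensor_power n \<Longrightarrow> A \<odot>\<^bsub>n\<^esub> B \<in> tensor_power n"
  unfolding tensor_mult_def sweedler_def
  by (intro tensor_class_closed lin_ext_free_words) (simp add: length_rep)

lemma pure_closed: "length w = n \<Longrightarrow> pure w \<in> tensor_power n"
  unfolding pure_def by (auto intro!: tensor_class_closed)

lemma tensor_one_closed [simp]: "tensor_one n \<in> tensor_power n"
  unfolding tensor_one_def by (simp add: pure_closed)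

lemma tensor_flip_closed [simp]: "A \<in> tensor_power 2 \<Longrightarrow> tensor_flip A \<in> tensor_power 2"
  unfolding tensor_flip_def sweedler_def
  by (intro tensor_class_closed lin_ext_free_words) simp

lemma incl_closed [simp]: "incl a \<in> tensor_power (Suc 0)"
  unfolding incl_def by (simp add: pure_closed)

lemma tensor_outer_closed:
  "A \<in> tensor_power m \<Longrightarrow> B \<in> tensor_power n \<Longrightarrow> m + n = k \<Longrightarrow> tensor_outer k A B \<in> tensor_power k"
  unfolding tensor_outer_def by (intro tensor_class_closed fconcat_free_words rep_free_words)

lemma ev_mult:
  assumes "A \<in> tensor_power n" "B \<in> tensor_power n" "multilinear n g"
  shows "ev (A \<odot>\<^bsub>n\<^esub> B) g = ev A (\<lambda>v. ev B (\<lambda>w. g (map2 (*) v w)))"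
proof -
  have "lin_ext fscale (\<lambda>v. lin_ext fscale (\<lambda>w. word (map2 (*) v w)) (rep B)) (rep A) \<in> free_words n"
    using assms by (intro lin_ext_free_words) (simp add: length_rep)
  from ev_class[OF this assms(3)] show ?thesis
    unfolding tensor_mult_def sweedler_def
    by (simp add: lin_ext_lin_ext vector_space_axioms)
qed

lemma ev_pure: "multilinear (length w) g \<Longrightarrow> ev (pure w) g = g w"
  by (simp add: pure_def ev_class vector_space_axioms)

lemma ev_one: "multilinear n g \<Longrightarrow> ev (tensor_one n) g = g (replicate n 1)"
  by (simp add: tensor_one_def ev_pure)

lemma ev_outer:
  assumes "A \<in> tensor_power m" "B \<in> tensor_power n" "m + n = k" "multilinear k g"
  shows "ev (tensor_outer k A B) g = ev A (\<lambda>v. ev B (\<lambda>w. g (v @ w)))"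
proof -
  have "fconcat (rep A) (rep B) \<in> free_words k"
    using assms by (intro fconcat_free_words rep_free_words)
  from ev_class[OF this assms(4)] show ?thesis
    by (simp add: tensor_outer_def lin_ext_fconcat vector_space_axioms)
      (simp add: sweedler_def)
qed

lemma multilinear_mult_right:
  assumes "multilinear n g" "length w = n"
  shows "multilinear n (\<lambda>v. g (map2 (*) v w))"
  unfolding multilinear_def
proof (intro allI impI)
  fix v v' :: "'h list" assume n: "Suc (length v + length v') = n"
  obtain w1 b w2 where w: "w = w1 @ b # w2" "length w1 = length v"
    using id_take_nth_drop[of "length v" w] n assms(2) by fastforce
  then have "length (map2 (*) v w1) = length v" "length (map2 (*) v' w2) = length v'"
    using n assms(2) by auto
  then have "lin (\<lambda>a. g (map2 (*) v w1 @ a # map2 (*) v' w2))"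
    using assms(1) n unfolding multilinear_def by metis
  then have "lin (\<lambda>a. g (map2 (*) v w1 @ (a * b) # map2 (*) v' w2))"
    by (rule lin_comp[where f = "\<lambda>a. a * b"]) (intro lin_mult_const lin_id)
  then show "lin (\<lambda>a. g (map2 (*) (v @ a # v') w))"
    using w by simp
qed

lemma multilinear_mult_left:
  assumes "multilinear n g" "length w = n"
  shows "multilinear n (\<lambda>v. g (map2 (*) w v))"
  unfolding multilinear_def
proof (intro allI impI)
  fix v v' :: "'h list" assume n: "Suc (length v + length v') = n"
  obtain w1 b w2 where w: "w = w1 @ b # w2" "length w1 = length v"
    using id_take_nth_drop[of "length v" w] n assms(2) by fastforce
  then have "length (map2 (*) w1 v) = length v" "length (map2 (*) w2 v') = length v'"
    using n assms(2) by auto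
  then have "lin (\<lambda>a. g (map2 (*) w1 v @ a # map2 (*) w2 v'))"
    using assms(1) n unfolding multilinear_def by metis
  then have "lin (\<lambda>a. g (map2 (*) w1 v @ (b * a) # map2 (*) w2 v'))"
    by (rule lin_comp[where f = "\<lambda>a. b * a"]) (intro lin_const_mult lin_id)
  then show "lin (\<lambda>a. g (map2 (*) w (v @ a # v')))"
    using w by simp
qed

lemma multilinear_ev:
  assumes "B \<in> tensor_power n" "\<And>w. length w = n \<Longrightarrow> multilinear m (\<lambda>v. f v w)"
  shows "multilinear m (\<lambda>v. ev B (f v))"
  unfolding multilinear_def
  using assms by (auto intro!: lin_ev_strong simp: multilinear_def dest: length_rep)

lemma tensor_mult_assoc:
  assumes A: "A \<in> tensor_power n" and B: "B \<in> tensor_power n" and C: "C \<in> tensor_power n"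
    and n: "n > 0"
  shows "(A \<odot>\<^bsub>n\<^esub> B) \<odot>\<^bsub>n\<^esub> C = A \<odot>\<^bsub>n\<^esub> (B \<odot>\<^bsub>n\<^esub> C)"
proof (rule tensor_eqI[OF _ _ n])
  fix g assume g: "multilinear n g"
  have assoc: "map2 (*) (map2 (*) u v) w = map2 (*) u (map2 (*) v w)" for u v w :: "'h list"
    by (rule nth_equalityI) (auto simp: mult.assoc)
  have "ev ((A \<odot>\<^bsub>n\<^esub> B) \<odot>\<^bsub>n\<^esub> C) g = ev (A \<odot>\<^bsub>n\<^esub> B) (\<lambda>v. ev C (\<lambda>w. g (map2 (*) v w)))"
    using A B C g by (simp add: ev_mult)
  also have "\<dots> = ev A (\<lambda>u. ev B (\<lambda>v. ev C (\<lambda>w. g (map2 (*) (map2 (*) u v) w))))"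
    using A B C g by (intro ev_mult multilinear_ev multilinear_mult_right)
  also have "\<dots> = ev A (\<lambda>u. ev (B \<odot>\<^bsub>n\<^esub> C) (\<lambda>v. g (map2 (*) u v)))"
    unfolding assoc using A
    by (rule ev_cong) (use B C g in \<open>simp add: ev_mult multilinear_mult_left\<close>)
  also have "\<dots> = ev (A \<odot>\<^bsub>n\<^esub> (B \<odot>\<^bsub>n\<^esub> C)) g"
    using A B C g by (simp add: ev_mult)
  finally show "ev ((A \<odot>\<^bsub>n\<^esub> B) \<odot>\<^bsub>n\<^esub> C) g = ev (A \<odot>\<^bsub>n\<^esub> (B \<odot>\<^bsub>n\<^esub> C)) g" .
qed (use A B C in simp_all)

lemma tensor_mult_one:
  assumes A: "A \<in> tensor_power n" and n: "n > 0"
  shows tensor_mult_one_right: "A \<odot>\<^bsub>n\<^esub> tensor_one n = A"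
    and tensor_mult_one_left: "tensor_one n \<odot>\<^bsub>n\<^esub> A = A"
proof -
  have [simp]: "map2 (*) v (replicate n 1) = v" "map2 (*) (replicate n 1) v = v"
    if "length v = n" for v :: "'h list"
    using that by (auto intro!: nth_equalityI)
  show "A \<odot>\<^bsub>n\<^esub> tensor_one n = A"
  proof (rule tensor_eqI[OF _ _ n])
    fix g assume g: "multilinear n g"
    have "ev (A \<odot>\<^bsub>n\<^esub> tensor_one n) g = ev A (\<lambda>v. ev (tensor_one n) (\<lambda>w. g (map2 (*) v w)))"
      using A g by (simp add: ev_mult)
    also have "\<dots> = ev A g"
      using A by (rule ev_cong) (use g in \<open>simp add: ev_one multilinear_mult_left\<close>)
    finally show "ev (A \<odot>\<^bsub>n\<^esub> tensor_one n) g = ev A g" .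
  qed (use A in simp_all)
  show "tensor_one n \<odot>\<^bsub>n\<^esub> A = A"
  proof (rule tensor_eqI[OF _ _ n])
    fix g assume g: "multilinear n g"
    have "ev (tensor_one n \<odot>\<^bsub>n\<^esub> A) g = ev A (\<lambda>w. g (map2 (*) (replicate n 1) w))"
      using A g by (simp add: ev_mult ev_one multilinear_ev multilinear_mult_right)
    also have "\<dots> = ev A g"
      using A by (rule ev_cong) simp
    finally show "ev (tensor_one n \<odot>\<^bsub>n\<^esub> A) g = ev A g" .
  qed (use A in simp_all)
qed

lemma tensor_inv_eqI:
  assumes "A \<in> tensor_power n" "B \<in> tensor_power n" "n > 0"
    and "A \<odot>\<^bsub>n\<^esub> B = tensor_one n" "B \<odot>\<^bsub>n\<^esub> A = tensor_one n"
  shows "tensor_inv n A = B"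
  unfolding tensor_inv_def
proof (rule the_equality)
  fix C assume "C \<in> tensor_power n \<and> A \<odot>\<^bsub>n\<^esub> C = tensor_one n \<and> C \<odot>\<^bsub>n\<^esub> A = tensor_one n"
  then show "C = B"
    using assms tensor_mult_assoc[of C n A B] by (simp add: tensor_mult_one)
qed (use assms in simp)

lemma tensor_invertibleD:
  assumes "A \<in> tensor_power n" "tensor_invertible n A" "n > 0"
  shows tensor_inv_closed: "tensor_inv n A \<in> tensor_power n"
    and tensor_inv_right: "A \<odot>\<^bsub>n\<^esub> tensor_inv n A = tensor_one n"
    and tensor_inv_left: "tensor_inv n A \<odot>\<^bsub>n\<^esub> A = tensor_one n"
proof -
  obtain B where "B \<in> tensor_power n" "A \<odot>\<^bsub>n\<^esub> B = tensor_one n" "B \<odot>\<^bsub>n\<^esub> A = tensor_one n"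
    using assms(2) by (auto simp: tensor_invertible_def)
  moreover from this have "tensor_inv n A = B"
    using assms by (intro tensor_inv_eqI)
  ultimately show "tensor_inv n A \<in> tensor_power n" "A \<odot>\<^bsub>n\<^esub> tensor_inv n A = tensor_one n"
    "tensor_inv n A \<odot>\<^bsub>n\<^esub> A = tensor_one n" by simp_all
qed

section \<open>Implicit summation in curried form\<close>

text \<open>Sums over the components of a tensor, with the components as separate arguments. As constants, in contrast to
  the abbreviations \<open>hsum2\<close> and \<open>hsum3\<close>, they leave the summand visible to higher-order matching as a function of its
  components.\<close>

definition sum2 :: "('k, 'h) tensor \<Rightarrow> ('h \<Rightarrow> 'h \<Rightarrow> 'h) \<Rightarrow> 'h" where
  "sum2 A g = ev A (\<lambda>w. g (w ! 0) (w ! 1))"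

definition sum3 :: "('k, 'h) tensor \<Rightarrow> ('h \<Rightarrow> 'h \<Rightarrow> 'h \<Rightarrow> 'h) \<Rightarrow> 'h" where
  "sum3 A g = ev A (\<lambda>w. g (w ! 0) (w ! 1) (w ! 2))"

definition sum4 :: "('k, 'h) tensor \<Rightarrow> ('h \<Rightarrow> 'h \<Rightarrow> 'h \<Rightarrow> 'h \<Rightarrow> 'h) \<Rightarrow> 'h" where
  "sum4 A g = ev A (\<lambda>w. g (w ! 0) (w ! 1) (w ! 2) (w ! 3))"

text \<open>Multilinearity in curried form. Together with the rules for \<open>lin\<close> the definitions decide, by simplification
  alone, whether a concrete summand is multilinear.\<close>

definition ml2 :: "('h \<Rightarrow> 'h \<Rightarrow> 'h) \<Rightarrow> bool" where
  "ml2 g \<longleftrightarrow> (\<forall>b. lin (\<lambda>a. g a b)) \<and> (\<forall>a. lin (\<lambda>b. g a b))"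

definition ml3 :: "('h \<Rightarrow> 'h \<Rightarrow> 'h \<Rightarrow> 'h) \<Rightarrow> bool" where
  "ml3 g \<longleftrightarrow> (\<forall>b c. lin (\<lambda>a. g a b c)) \<and> (\<forall>a c. lin (\<lambda>b. g a b c)) \<and> (\<forall>a b. lin (\<lambda>c. g a b c))"

definition ml4 :: "('h \<Rightarrow> 'h \<Rightarrow> 'h \<Rightarrow> 'h \<Rightarrow> 'h) \<Rightarrow> bool" where
  "ml4 g \<longleftrightarrow> (\<forall>b c d. lin (\<lambda>a. g a b c d)) \<and> (\<forall>a c d. lin (\<lambda>b. g a b c d)) \<and>
     (\<forall>a b d. lin (\<lambda>c. g a b c d)) \<and> (\<forall>a b c. lin (\<lambda>d. g a b c d))"

lemma length_2_cases: "length w = 2 \<Longrightarrow> (\<And>x y. w = [x, y] \<Longrightarrow> P) \<Longrightarrow> P"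
  by (auto simp: numeral_eq_Suc length_Suc_conv)

lemma length_3_cases: "length w = 3 \<Longrightarrow> (\<And>x y z. w = [x, y, z] \<Longrightarrow> P) \<Longrightarrow> P"
  by (auto simp: numeral_eq_Suc length_Suc_conv)

lemma length_4_cases: "length w = 4 \<Longrightarrow> (\<And>x y z t. w = [x, y, z, t] \<Longrightarrow> P) \<Longrightarrow> P"
  by (auto simp: numeral_eq_Suc length_Suc_conv)

lemma ev_eq_sum:
  shows ev_eq_sum2: "A \<in> tensor_power 2 \<Longrightarrow> ev A f = sum2 A (\<lambda>a b. f [a, b])"
    and ev_eq_sum3: "A \<in> tensor_power 3 \<Longrightarrow> ev A f = sum3 A (\<lambda>a b c. f [a, b, c])"
    and ev_eq_sum4: "A \<in> tensor_power 4 \<Longrightarrow> ev A f = sum4 A (\<lambda>a b c d. f [a, b, c, d])"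
proof -
  show "ev A f = sum2 A (\<lambda>a b. f [a, b])" if "A \<in> tensor_power 2"
    unfolding sum2_def by (rule ev_cong[OF that]) (auto elim!: length_2_cases)
  show "ev A f = sum3 A (\<lambda>a b c. f [a, b, c])" if "A \<in> tensor_power 3"
    unfolding sum3_def by (rule ev_cong[OF that]) (auto elim!: length_3_cases)
  show "ev A f = sum4 A (\<lambda>a b c d. f [a, b, c, d])" if "A \<in> tensor_power 4"
    unfolding sum4_def by (rule ev_cong[OF that]) (auto elim!: length_4_cases)
qed

lemma multilinear_2: "multilinear 2 (\<lambda>w. g (w ! 0) (w ! 1)) \<longleftrightarrow> ml2 g" (is "multilinear 2 ?G \<longleftrightarrow> _")
proof
  assume G: "multilinear 2 ?G"
  show "ml2 g"
    unfolding ml2_def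
    using G[unfolded multilinear_def, rule_format, of "[]" "[_]"]
      G[unfolded multilinear_def, rule_format, of "[_]" "[]"] by simp
next
  assume g: "ml2 g"
  show "multilinear 2 ?G"
    unfolding multilinear_def
  proof (intro allI impI)
    fix v w :: "'h list" assume n: "Suc (length v + length w) = 2"
    then consider "length v = 0" "length w = 1" | "length v = 1" "length w = 0"
      by linarith
    then show "lin (\<lambda>a. ?G (v @ a # w))"
      by cases (use g in \<open>auto simp: ml2_def length_Suc_conv\<close>)
  qed
qed

lemma multilinear_3:
  "multilinear 3 (\<lambda>w. g (w ! 0) (w ! 1) (w ! 2)) \<longleftrightarrow> ml3 g" (is "multilinear 3 ?G \<longleftrightarrow> _")
proof
  assume G: "multilinear 3 ?G"
  show "ml3 g"
    unfolding ml3_def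
    using G[unfolded multilinear_def, rule_format, of "[]" "[_, _]"]
      G[unfolded multilinear_def, rule_format, of "[_]" "[_]"]
      G[unfolded multilinear_def, rule_format, of "[_, _]" "[]"] by simp
next
  assume g: "ml3 g"
  show "multilinear 3 ?G"
    unfolding multilinear_def
  proof (intro allI impI)
    fix v w :: "'h list" assume n: "Suc (length v + length w) = 3"
    then consider "length v = 0" "length w = 2" | "length v = 1" "length w = 1"
      | "length v = 2" "length w = 0"
      by linarith
    then show "lin (\<lambda>a. ?G (v @ a # w))"
      by cases (use g in \<open>auto simp: ml3_def length_Suc_conv elim!: length_2_cases\<close>)
  qed
qed

lemma multilinear_4:
  "multilinear 4 (\<lambda>w. g (w ! 0) (w ! 1) (w ! 2) (w ! 3)) \<longleftrightarrow> ml4 g" (is "multilinear 4 ?G \<longleftrightarrow> _")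
proof
  assume G: "multilinear 4 ?G"
  show "ml4 g"
    unfolding ml4_def
    using G[unfolded multilinear_def, rule_format, of "[]" "[_, _, _]"]
      G[unfolded multilinear_def, rule_format, of "[_]" "[_, _]"]
      G[unfolded multilinear_def, rule_format, of "[_, _]" "[_]"]
      G[unfolded multilinear_def, rule_format, of "[_, _, _]" "[]"] by simp
next
  assume g: "ml4 g"
  show "multilinear 4 ?G"
    unfolding multilinear_def
  proof (intro allI impI)
    fix v w :: "'h list" assume n: "Suc (length v + length w) = 4"
    then consider "length v = 0" "length w = 3" | "length v = 1" "length w = 2"
      | "length v = 2" "length w = 1" | "length v = 3" "length w = 0"
      by linarith
    then show "lin (\<lambda>a. ?G (v @ a # w))"
      by cases (use g in \<open>auto simp: ml4_def length_Suc_conv elim!: length_2_cases length_3_cases\<close>)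
  qed
qed

lemmas multilinear_nth = multilinear_2 multilinear_3 multilinear_4

lemma
  shows sum2_lin: "lin f \<Longrightarrow> f (sum2 A g2) = sum2 A (\<lambda>a b. f (g2 a b))"
    and sum3_lin: "lin f \<Longrightarrow> f (sum3 A g3) = sum3 A (\<lambda>a b c. f (g3 a b c))"
  unfolding sum2_def sum3_def by (simp_all add: ev_lin)

lemma
  shows lin_sum2: "(\<And>a b. lin (\<lambda>x. g2 x a b)) \<Longrightarrow> lin (\<lambda>x. sum2 A (\<lambda>a b. g2 x a b))"
    and lin_sum3: "(\<And>a b c. lin (\<lambda>x. g3 x a b c)) \<Longrightarrow> lin (\<lambda>x. sum3 A (\<lambda>a b c. g3 x a b c))"
  unfolding sum2_def sum3_def by (simp_all add: lin_ev)

lemma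
  shows sum2_sum3_swap: "sum2 A (\<lambda>a b. sum3 B (\<lambda>c d e. f a b c d e)) =
      sum3 B (\<lambda>c d e. sum2 A (\<lambda>a b. f a b c d e))"
    and sum2_sum2_swap: "sum2 A (\<lambda>a b. sum2 B (\<lambda>c d. g a b c d)) =
      sum2 B (\<lambda>c d. sum2 A (\<lambda>a b. g a b c d))"
    and sum3_sum3_swap: "sum3 A (\<lambda>a b c. sum3 B (\<lambda>d e f. h a b c d e f)) =
      sum3 B (\<lambda>d e f. sum3 A (\<lambda>a b c. h a b c d e f))"
  unfolding sum2_def sum3_def by (rule ev_swap)+

lemma
  shows sum2_mult: "A \<in> tensor_power 2 \<Longrightarrow> B \<in> tensor_power 2 \<Longrightarrow> ml2 g2 \<Longrightarrow>
      sum2 (A \<odot>\<^bsub>2\<^esub> B) g2 = sum2 A (\<lambda>a b. sum2 B (\<lambda>c d. g2 (a * c) (b * d)))"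
    and sum3_mult: "A' \<in> tensor_power 3 \<Longrightarrow> B' \<in> tensor_power 3 \<Longrightarrow> ml3 g3 \<Longrightarrow>
      sum3 (A' \<odot>\<^bsub>3\<^esub> B') g3 = sum3 A' (\<lambda>a b c. sum3 B' (\<lambda>x y z. g3 (a * x) (b * y) (c * z)))"
    and sum4_mult: "A'' \<in> tensor_power 4 \<Longrightarrow> B'' \<in> tensor_power 4 \<Longrightarrow> ml4 g4 \<Longrightarrow>
      sum4 (A'' \<odot>\<^bsub>4\<^esub> B'') g4 =
        sum4 A'' (\<lambda>a b c d. sum4 B'' (\<lambda>x y z t. g4 (a * x) (b * y) (c * z) (d * t)))"
  unfolding sum2_def[of "_ \<odot>\<^bsub>_\<^esub> _"] sum3_def[of "_ \<odot>\<^bsub>_\<^esub> _"] sum4_def[of "_ \<odot>\<^bsub>_\<^esub> _"]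
  by (simp_all add: ev_mult multilinear_nth del: One_nat_def) (simp_all add: ev_eq_sum)

lemma
  shows sum2_one: "ml2 g2 \<Longrightarrow> sum2 (tensor_one 2) g2 = g2 1 1"
    and sum3_one: "ml3 g3 \<Longrightarrow> sum3 (tensor_one 3) g3 = g3 1 1 1"
    and sum4_one: "ml4 g4 \<Longrightarrow> sum4 (tensor_one 4) g4 = g4 1 1 1 1"
  unfolding sum2_def sum3_def sum4_def
  by (simp_all add: ev_one multilinear_nth del: One_nat_def)

lemma sum2_pure: "ml2 g \<Longrightarrow> sum2 (pure [a, b]) g = g a b"
  unfolding sum2_def by (simp add: ev_pure multilinear_nth numeral_2_eq_2[symmetric] del: One_nat_def)

lemma sum2_flip:
  assumes "A \<in> tensor_power 2" "ml2 g"
  shows "sum2 (tensor_flip A) g = sum2 A (\<lambda>a b. g b a)"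
proof -
  have "lin_ext fscale (\<lambda>w. word [w ! 1, w ! 0]) (rep A) \<in> free_words 2"
    by (intro lin_ext_free_words) simp
  moreover have "multilinear 2 (\<lambda>w. g (w ! 0) (w ! 1))"
    using assms(2) by (simp add: multilinear_2 del: One_nat_def)
  ultimately show ?thesis
    unfolding sum2_def tensor_flip_def sweedler_def[of fscale]
    by (simp add: ev_class lin_ext_lin_ext vector_space_axioms) (simp add: sweedler_def)
qed

lemma tensor2_eqI:
  assumes "A \<in> tensor_power 2" "B \<in> tensor_power 2"
    and "\<And>g. ml2 g \<Longrightarrow> sum2 A g = sum2 B g"
  shows "A = B"
proof (rule tensor_eqI[OF assms(1,2)])
  fix g assume g: "multilinear 2 g"
  have "ml2 (\<lambda>a b. g [a, b])"
    unfolding ml2_def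
  proof (intro conjI allI)
    show "lin (\<lambda>a. g [a, b])" for b
      using g[unfolded multilinear_def, rule_format, of "[]" "[b]"] by simp
    show "lin (\<lambda>b. g [a, b])" for a
      using g[unfolded multilinear_def, rule_format, of "[a]" "[]"] by simp
  qed
  with assms show "ev A g = ev B g"
    by (simp add: ev_eq_sum)
qed simp

lemma tensor4_eqI:
  assumes "A \<in> tensor_power 4" "B \<in> tensor_power 4"
    and "\<And>g. ml4 g \<Longrightarrow> sum4 A g = sum4 B g"
  shows "A = B"
proof (rule tensor_eqI[OF assms(1,2)])
  fix g assume g: "multilinear 4 g"
  have "ml4 (\<lambda>a b c d. g [a, b, c, d])"
    unfolding ml4_def
  proof (intro conjI allI)
    fix a b c d :: 'h
    show "lin (\<lambda>a. g [a, b, c, d])"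
      using g[unfolded multilinear_def, rule_format, of "[]" "[b, c, d]"] by simp
    show "lin (\<lambda>b. g [a, b, c, d])"
      using g[unfolded multilinear_def, rule_format, of "[a]" "[c, d]"] by simp
    show "lin (\<lambda>c. g [a, b, c, d])"
      using g[unfolded multilinear_def, rule_format, of "[a, b]" "[d]"] by simp
    show "lin (\<lambda>d. g [a, b, c, d])"
      using g[unfolded multilinear_def, rule_format, of "[a, b, c]" "[]"] by simp
  qed
  with assms show "ev A g = ev B g"
    by (simp add: ev_eq_sum)
qed simp

lemmas lin_intros = lin_id lin_mult_const lin_const_mult lin_scale lin_sum2 lin_sum3

text \<open>Composition rules for an unspecified multilinear map, to be instantiated with that map so that the simplifier
  sees an ordinary pattern.\<close>

lemma ml2_comp:
  assumes "ml2 g" "lin f"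
  shows "lin (\<lambda>x. g (f x) b)" "lin (\<lambda>x. g a (f x))"
  using assms by (auto simp: ml2_def lin_def)

lemma ml3_comp:
  assumes "ml3 g" "lin f"
  shows "lin (\<lambda>x. g (f x) b c)" "lin (\<lambda>x. g a (f x) c)" "lin (\<lambda>x. g a b (f x))"
  using assms by (auto simp: ml3_def lin_def)

lemma ml4_comp:
  assumes "ml4 g" "lin f"
  shows "lin (\<lambda>x. g (f x) b c d)" "lin (\<lambda>x. g a (f x) c d)" "lin (\<lambda>x. g a b (f x) d)"
    "lin (\<lambda>x. g a b c (f x))"
  using assms by (auto simp: ml4_def lin_def)

lemma tensor_flip_mult:
  assumes "A \<in> tensor_power 2" "B \<in> tensor_power 2"
  shows "tensor_flip (A \<odot>\<^bsub>2\<^esub> B) = tensor_flip A \<odot>\<^bsub>2\<^esub> tensor_flip B"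
proof (rule tensor2_eqI)
  fix g assume g: "ml2 g"
  note [simp] = ml2_comp[OF g] lin_intros
  show "sum2 (tensor_flip (A \<odot>\<^bsub>2\<^esub> B)) g = sum2 (tensor_flip A \<odot>\<^bsub>2\<^esub> tensor_flip B) g"
    using assms g by (simp add: sum2_flip sum2_mult ml2_def)
qed (use assms in simp_all)

lemma tensor_flip_one: "tensor_flip (tensor_one 2) = tensor_one 2"
  by (rule tensor2_eqI) (simp_all add: sum2_flip sum2_one ml2_def)

text \<open>The inverse of \<open>R\<^sub>2\<^sub>1R\<close> is \<open>R\<^sup>-\<^sup>1(R\<^sup>-\<^sup>1)\<^sub>2\<^sub>1\<close>, because the flip is multiplicative.\<close>

lemma tensor_invertible_flip_mult:
  assumes A: "A \<in> tensor_power 2" and "tensor_invertible 2 A"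
  shows "tensor_invertible 2 (tensor_flip A \<odot>\<^bsub>2\<^esub> A)"
proof -
  obtain B where B: "B \<in> tensor_power 2" "A \<odot>\<^bsub>2\<^esub> B = tensor_one 2" "B \<odot>\<^bsub>2\<^esub> A = tensor_one 2"
    using assms by (auto simp: tensor_invertible_def)
  have flip: "tensor_flip A \<odot>\<^bsub>2\<^esub> tensor_flip B = tensor_one 2" "tensor_flip B \<odot>\<^bsub>2\<^esub> tensor_flip A = tensor_one 2"
    using A B by (simp_all flip: tensor_flip_mult add: tensor_flip_one)
  have "(tensor_flip A \<odot>\<^bsub>2\<^esub> A) \<odot>\<^bsub>2\<^esub> (B \<odot>\<^bsub>2\<^esub> tensor_flip B)
      = tensor_flip A \<odot>\<^bsub>2\<^esub> ((A \<odot>\<^bsub>2\<^esub> B) \<odot>\<^bsub>2\<^esub> tensor_flip B)"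
    using A B(1) by (simp add: tensor_mult_assoc)
  moreover have "(B \<odot>\<^bsub>2\<^esub> tensor_flip B) \<odot>\<^bsub>2\<^esub> (tensor_flip A \<odot>\<^bsub>2\<^esub> A)
      = B \<odot>\<^bsub>2\<^esub> ((tensor_flip B \<odot>\<^bsub>2\<^esub> tensor_flip A) \<odot>\<^bsub>2\<^esub> A)"
    using A B(1) by (simp add: tensor_mult_assoc)
  ultimately show ?thesis
    unfolding tensor_invertible_def using A B flip
    by (intro bexI[of _ "B \<odot>\<^bsub>2\<^esub> tensor_flip B"]) (simp_all add: tensor_mult_one)
qed

section \<open>Tensor products of tensors and of maps\<close>

lemma sum2_add:
  assumes "A \<in> tensor_power 2" "B \<in> tensor_power 2" "ml2 g"
  shows "sum2 (tensor_add 2 A B) g = sum2 A g + sum2 B g"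
proof -
  interpret L: Vector_Spaces.linear fscale scale "lin_ext scale h" for h
    by (rule linear_lin_ext[OF vector_space_axioms])
  have "rep A + rep B \<in> free_words 2"
    using rep_free_words[OF assms(1)] rep_free_words[OF assms(2)] Poly_Mapping.keys_add[of "rep A" "rep B"]
    by (fastforce simp: free_words_def)
  moreover have "multilinear 2 (\<lambda>w. g (w ! 0) (w ! 1))"
    using assms(3) by (simp add: multilinear_2 del: One_nat_def)
  ultimately show ?thesis
    unfolding sum2_def tensor_add_def by (simp add: ev_class L.add) (simp add: sweedler_def)
qed

lemma sum2_scale:
  assumes "A \<in> tensor_power 2" "ml2 g"
  shows "sum2 (tensor_scale 2 c A) g = c *s sum2 A g"
proof -
  interpret L: Vector_Spaces.linear fscale scale "lin_ext scale h" for h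
    by (rule linear_lin_ext[OF vector_space_axioms])
  have "fscale c (rep A) \<in> free_words 2"
    using rep_free_words[OF assms(1)] by (auto simp: free_words_def in_keys_iff)
  moreover have "multilinear 2 (\<lambda>w. g (w ! 0) (w ! 1))"
    using assms(2) by (simp add: multilinear_2 del: One_nat_def)
  ultimately show ?thesis
    unfolding sum2_def tensor_scale_def by (simp add: ev_class L.scale) (simp add: sweedler_def)
qed

lemma map_free_words:
  assumes "list_all2 (\<lambda>f k. \<forall>a. f a \<in> tensor_power k) fs ks" "length w = length fs"
  shows "foldr fconcat (map2 (\<lambda>f a. rep (f a)) fs w) (word []) \<in> free_words (sum_list ks)"
  using assms
proof (induction arbitrary: w rule: list_all2_induct)
  case (Cons f fs k ks)
  then obtain a w' where w: "w = a # w'" by (cases w) auto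
  with Cons have "foldr fconcat (map2 (\<lambda>f a. rep (f a)) fs w') (word []) \<in> free_words (sum_list ks)"
    by simp
  with Cons(1) show ?case
    by (auto simp: w intro!: fconcat_free_words rep_free_words)
qed simp

lemma tensor_map_closed:
  assumes "list_all2 (\<lambda>f k. \<forall>a. f a \<in> tensor_power k) fs ks" "sum_list ks = m"
    and "length fs = n" and "A \<in> tensor_power n"
  shows "tensor_map m fs A \<in> tensor_power m"
  unfolding tensor_map_def sweedler_def
  using map_free_words[OF assms(1)] assms(2,3,4)
  by (intro tensor_class_closed lin_ext_free_words) (simp add: length_rep)

lemma ev_map:
  assumes "list_all2 (\<lambda>f k. \<forall>a. f a \<in> tensor_power k) fs ks" "sum_list ks = m"
    and "length fs = n" and "A \<in> tensor_power n" "multilinear m g"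
  shows "ev (tensor_map m fs A) g =
    ev A (\<lambda>w. lin_ext scale g (foldr fconcat (map2 (\<lambda>f a. rep (f a)) fs w) (word [])))"
proof -
  have "lin_ext fscale (\<lambda>w. foldr fconcat (map2 (\<lambda>f a. rep (f a)) fs w) (word [])) (rep A) \<in> free_words m"
    using map_free_words[OF assms(1)] assms(2,3,4)
    by (intro lin_ext_free_words) (simp add: length_rep)
  from ev_class[OF this assms(5)] show ?thesis
    unfolding tensor_map_def by (simp add: sweedler_def lin_ext_lin_ext vector_space_axioms)
qed

lemma ev_incl:
  assumes "lin (\<lambda>x. g [x])"
  shows "ev (incl a) g = g [a]"
proof -
  have "multilinear 1 g" using assms by (simp add: multilinear_def)
  then show ?thesis by (simp add: incl_def ev_pure)
qed

end

context quasi_bialgebra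
begin

section \<open>Coassociativity and the pentagon as identities of sums\<close>

abbreviation \<psi> where "\<psi> \<equiv> tensor_inv 3 \<Phi>"

lemma \<psi>_closed [simp]: "\<psi> \<in> tensor_power 3"
  and reassociator_inv: "\<Phi> \<odot>\<^bsub>3\<^esub> \<psi> = tensor_one 3" "\<psi> \<odot>\<^bsub>3\<^esub> \<Phi> = tensor_one 3"
  using tensor_invertibleD[OF reassociator_closed reassociator_invertible] by simp_all

declare comult_closed [simp] reassociator_closed [simp]

lemma lin_comult:
  assumes "ml2 g" "lin f"
  shows "lin (\<lambda>x. sum2 (\<Delta> (f x)) g)"
  using assms unfolding lin_def by (auto simp: comult_add comult_scale sum2_add sum2_scale)

lemma sum3_map:
  assumes A: "A \<in> tensor_power 2" and g: "ml3 g"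
  shows "sum3 (tensor_map 3 [incl, \<Delta>] A) g = sum2 A (\<lambda>a b. sum2 (\<Delta> b) (\<lambda>c d. g a c d))"
    and "sum3 (tensor_map 3 [\<Delta>, incl] A) g = sum2 A (\<lambda>a b. sum2 (\<Delta> a) (\<lambda>c d. g c d b))"
proof -
  let ?G = "\<lambda>w. g (w ! 0) (w ! 1) (w ! 2)"
  note lin [simp] = ml3_comp[OF g] lin_intros
  have G: "multilinear 3 ?G" using g by (simp add: multilinear_3 del: One_nat_def)
  have 1: "ev (tensor_map 3 [incl, \<Delta>] A) ?G =
      ev A (\<lambda>w. lin_ext scale ?G (foldr fconcat (map2 (\<lambda>f a. rep (f a)) [incl, \<Delta>] w) (word [])))"
    by (rule ev_map[where ks = "[1, 2]" and n = 2]) (use A G in \<open>simp_all\<close>)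
  have 2: "ev (tensor_map 3 [\<Delta>, incl] A) ?G =
      ev A (\<lambda>w. lin_ext scale ?G (foldr fconcat (map2 (\<lambda>f a. rep (f a)) [\<Delta>, incl] w) (word [])))"
    by (rule ev_map[where ks = "[2, 1]" and n = 2]) (use A G in \<open>simp_all\<close>)
  show "sum3 (tensor_map 3 [incl, \<Delta>] A) g = sum2 A (\<lambda>a b. sum2 (\<Delta> b) (\<lambda>c d. g a c d))"
    unfolding sum3_def 1 using A
    by (simp add: ev_eq_sum lin_ext_fconcat vector_space_axioms)
      (simp add: ev_incl ev_eq_sum flip: sweedler_def)
  show "sum3 (tensor_map 3 [\<Delta>, incl] A) g = sum2 A (\<lambda>a b. sum2 (\<Delta> a) (\<lambda>c d. g c d b))"
    unfolding sum3_def 2 using A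
    by (simp add: ev_eq_sum lin_ext_fconcat vector_space_axioms)
      (simp add: ev_incl ev_eq_sum flip: sweedler_def)
qed

lemma sum4_map:
  assumes A: "A \<in> tensor_power 3" and g: "ml4 g"
  shows "sum4 (tensor_map 4 [\<Delta>, incl, incl] A) g = sum3 A (\<lambda>a b c. sum2 (\<Delta> a) (\<lambda>x y. g x y b c))"
    and "sum4 (tensor_map 4 [incl, \<Delta>, incl] A) g = sum3 A (\<lambda>a b c. sum2 (\<Delta> b) (\<lambda>x y. g a x y c))"
    and "sum4 (tensor_map 4 [incl, incl, \<Delta>] A) g = sum3 A (\<lambda>a b c. sum2 (\<Delta> c) (\<lambda>x y. g a b x y))"
proof -
  let ?G = "\<lambda>w. g (w ! 0) (w ! 1) (w ! 2) (w ! 3)"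
  note lin [simp] = ml4_comp[OF g] lin_intros
  have G: "multilinear 4 ?G" using g by (simp add: multilinear_4 del: One_nat_def)
  have 1: "ev (tensor_map 4 [\<Delta>, incl, incl] A) ?G =
      ev A (\<lambda>w. lin_ext scale ?G (foldr fconcat (map2 (\<lambda>f a. rep (f a)) [\<Delta>, incl, incl] w) (word [])))"
    by (rule ev_map[where ks = "[2, 1, 1]" and n = 3]) (use A G in \<open>simp_all\<close>)
  have 2: "ev (tensor_map 4 [incl, \<Delta>, incl] A) ?G =
      ev A (\<lambda>w. lin_ext scale ?G (foldr fconcat (map2 (\<lambda>f a. rep (f a)) [incl, \<Delta>, incl] w) (word [])))"
    by (rule ev_map[where ks = "[1, 2, 1]" and n = 3]) (use A G in \<open>simp_all\<close>)
  have 3: "ev (tensor_map 4 [incl, incl, \<Delta>] A) ?G =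
      ev A (\<lambda>w. lin_ext scale ?G (foldr fconcat (map2 (\<lambda>f a. rep (f a)) [incl, incl, \<Delta>] w) (word [])))"
    by (rule ev_map[where ks = "[1, 1, 2]" and n = 3]) (use A G in \<open>simp_all\<close>)
  show "sum4 (tensor_map 4 [\<Delta>, incl, incl] A) g = sum3 A (\<lambda>a b c. sum2 (\<Delta> a) (\<lambda>x y. g x y b c))"
    unfolding sum4_def 1 using A
    by (simp add: ev_eq_sum lin_ext_fconcat vector_space_axioms)
      (simp add: ev_incl ev_eq_sum flip: sweedler_def)
  show "sum4 (tensor_map 4 [incl, \<Delta>, incl] A) g = sum3 A (\<lambda>a b c. sum2 (\<Delta> b) (\<lambda>x y. g a x y c))"
    unfolding sum4_def 2 using A
    by (simp add: ev_eq_sum lin_ext_fconcat vector_space_axioms)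
      (simp add: ev_incl ev_eq_sum flip: sweedler_def)
  show "sum4 (tensor_map 4 [incl, incl, \<Delta>] A) g = sum3 A (\<lambda>a b c. sum2 (\<Delta> c) (\<lambda>x y. g a b x y))"
    unfolding sum4_def 3 using A
    by (simp add: ev_eq_sum lin_ext_fconcat vector_space_axioms)
      (simp add: ev_incl ev_eq_sum flip: sweedler_def)
qed

lemma sum4_outer:
  assumes A: "A \<in> tensor_power 3" and g: "ml4 g"
  shows "sum4 (tensor_outer 4 (tensor_one 1) A) g = sum3 A (\<lambda>a b c. g 1 a b c)"
    and "sum4 (tensor_outer 4 A (tensor_one 1)) g = sum3 A (\<lambda>a b c. g a b c 1)"
proof -
  note lin [simp] = ml4_comp[OF g] lin_intros
  have G: "multilinear 4 (\<lambda>w. g (w ! 0) (w ! 1) (w ! 2) (w ! 3))" using g by (simp add: multilinear_4 del: One_nat_def)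
  have one: "tensor_one (Suc 0) = incl 1" by (simp add: tensor_one_def incl_def)
  have "incl 1 \<in> tensor_power (Suc 0)" by simp
  note outer = ev_outer[OF this A _ G, simplified] ev_outer[OF A this _ G, simplified]
  show "sum4 (tensor_outer 4 (tensor_one 1) A) g = sum3 A (\<lambda>a b c. g 1 a b c)"
    "sum4 (tensor_outer 4 A (tensor_one 1)) g = sum3 A (\<lambda>a b c. g a b c 1)"
    unfolding sum4_def using A by (simp_all add: one outer) (simp_all add: ev_incl ev_eq_sum)
qed

lemma tensor_maps_closed [simp]:
  "A \<in> tensor_power 3 \<Longrightarrow> tensor_map 4 [\<Delta>, incl, incl] A \<in> tensor_power 4"
  "A \<in> tensor_power 3 \<Longrightarrow> tensor_map 4 [incl, \<Delta>, incl] A \<in> tensor_power 4"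
  "A \<in> tensor_power 3 \<Longrightarrow> tensor_map 4 [incl, incl, \<Delta>] A \<in> tensor_power 4"
  "A \<in> tensor_power 3 \<Longrightarrow> tensor_outer 4 A (tensor_one (Suc 0)) \<in> tensor_power 4"
  "A \<in> tensor_power 3 \<Longrightarrow> tensor_outer 4 (tensor_one (Suc 0)) A \<in> tensor_power 4"
  "B \<in> tensor_power 2 \<Longrightarrow> tensor_map 3 [\<Delta>, incl] B \<in> tensor_power 3"
  "B \<in> tensor_power 2 \<Longrightarrow> tensor_map 3 [incl, \<Delta>] B \<in> tensor_power 3"
  by (simp_all add: tensor_outer_closed[where m = 3 and n = 1] tensor_outer_closed[where m = 1 and n = 3]
      tensor_map_closed[where ks = "[2, 1, 1]" and n = 3] tensor_map_closed[where ks = "[1, 2, 1]" and n = 3]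
      tensor_map_closed[where ks = "[1, 1, 2]" and n = 3] tensor_map_closed[where ks = "[2, 1]" and n = 2]
      tensor_map_closed[where ks = "[1, 2]" and n = 2])

lemma lin_counit:
  assumes "lin f"
  shows "lin (\<lambda>x. \<epsilon> (f x) *s c)" "lin (\<lambda>x. (\<epsilon> (f x) * r) *s c)" "lin (\<lambda>x. (r * \<epsilon> (f x)) *s c)"
proof -
  interpret \<epsilon>: Vector_Spaces.linear scale "(*)" \<epsilon> by (rule counit_linear)
  have *: "lin (\<lambda>x. \<epsilon> (f x) *s c)" for c
    using assms by (simp add: lin_def \<epsilon>.add \<epsilon>.scale scale_left_distrib)
  then show "lin (\<lambda>x. \<epsilon> (f x) *s c)" .
  show **: "lin (\<lambda>x. (\<epsilon> (f x) * r) *s c)"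
    using *[of "r *s c"] by (simp only: scale_scale)
  then show "lin (\<lambda>x. (r * \<epsilon> (f x)) *s c)"
    by (simp only: mult.commute)
qed

lemmas ml_simps = lin_intros lin_comult lin_counit ml2_def ml3_def ml4_def

lemma
  assumes "lin f"
  shows sum_comult_counit_right: "sum2 (\<Delta> h) (\<lambda>a b. \<epsilon> b *s f a) = f h"
    and sum_comult_counit_left: "sum2 (\<Delta> h) (\<lambda>a b. \<epsilon> a *s f b) = f h"
proof -
  have f: "f (c *s a) = c *s f a" for c a using assms by (simp add: lin_def)
  show "sum2 (\<Delta> h) (\<lambda>a b. \<epsilon> b *s f a) = f h" "sum2 (\<Delta> h) (\<lambda>a b. \<epsilon> a *s f b) = f h"
    using counit_right[of h] counit_left[of h]
    unfolding f[symmetric] sum2_lin[OF assms, symmetric]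
    by (simp_all add: sum2_def)
qed

text \<open>Both sides have the same sums against every multilinear map, because \<open>\<Delta>\<close> is multiplicative and sums over
  independent tensors can be exchanged.\<close>

lemma tensor_map_algebra_hom:
  assumes A: "A \<in> tensor_power 3" and B: "B \<in> tensor_power 3"
  shows "tensor_map 4 [incl, incl, \<Delta>] (A \<odot>\<^bsub>3\<^esub> B)
      = tensor_map 4 [incl, incl, \<Delta>] A \<odot>\<^bsub>4\<^esub> tensor_map 4 [incl, incl, \<Delta>] B"
    and "tensor_map 4 [incl, \<Delta>, incl] (A \<odot>\<^bsub>3\<^esub> B)
      = tensor_map 4 [incl, \<Delta>, incl] A \<odot>\<^bsub>4\<^esub> tensor_map 4 [incl, \<Delta>, incl] B"
    and "tensor_outer 4 (A \<odot>\<^bsub>3\<^esub> B) (tensor_one 1)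
      = tensor_outer 4 A (tensor_one 1) \<odot>\<^bsub>4\<^esub> tensor_outer 4 B (tensor_one 1)"
proof -
  note [simp] = sum4_mult sum3_mult sum2_mult sum4_map sum4_outer[simplified] comult_mult A B
  show "tensor_map 4 [incl, incl, \<Delta>] (A \<odot>\<^bsub>3\<^esub> B)
      = tensor_map 4 [incl, incl, \<Delta>] A \<odot>\<^bsub>4\<^esub> tensor_map 4 [incl, incl, \<Delta>] B"
  proof (rule tensor4_eqI)
    fix g assume g: "ml4 g"
    note [simp] = ml4_comp[OF g] ml_simps
    show "sum4 (tensor_map 4 [incl, incl, \<Delta>] (A \<odot>\<^bsub>3\<^esub> B)) g =
        sum4 (tensor_map 4 [incl, incl, \<Delta>] A \<odot>\<^bsub>4\<^esub> tensor_map 4 [incl, incl, \<Delta>] B) g"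
      by (simp add: sum2_sum3_swap)
  qed simp_all
  show "tensor_map 4 [incl, \<Delta>, incl] (A \<odot>\<^bsub>3\<^esub> B)
      = tensor_map 4 [incl, \<Delta>, incl] A \<odot>\<^bsub>4\<^esub> tensor_map 4 [incl, \<Delta>, incl] B"
  proof (rule tensor4_eqI)
    fix g assume g: "ml4 g"
    note [simp] = ml4_comp[OF g] ml_simps
    show "sum4 (tensor_map 4 [incl, \<Delta>, incl] (A \<odot>\<^bsub>3\<^esub> B)) g =
        sum4 (tensor_map 4 [incl, \<Delta>, incl] A \<odot>\<^bsub>4\<^esub> tensor_map 4 [incl, \<Delta>, incl] B) g"
      by (simp add: sum2_sum3_swap)
  qed simp_all
  show "tensor_outer 4 (A \<odot>\<^bsub>3\<^esub> B) (tensor_one 1)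
      = tensor_outer 4 A (tensor_one 1) \<odot>\<^bsub>4\<^esub> tensor_outer 4 B (tensor_one 1)"
  proof (rule tensor4_eqI)
    fix g assume g: "ml4 g"
    note [simp] = ml4_comp[OF g] ml_simps
    show "sum4 (tensor_outer 4 (A \<odot>\<^bsub>3\<^esub> B) (tensor_one 1)) g =
        sum4 (tensor_outer 4 A (tensor_one 1) \<odot>\<^bsub>4\<^esub> tensor_outer 4 B (tensor_one 1)) g"
      by simp
  qed simp_all
qed

lemma tensor_map_unit:
  "tensor_map 4 [incl, incl, \<Delta>] (tensor_one 3) = tensor_one 4"
  "tensor_map 4 [incl, \<Delta>, incl] (tensor_one 3) = tensor_one 4"
  "tensor_outer 4 (tensor_one 3) (tensor_one 1) = tensor_one 4"
proof -
  note [simp] = sum3_one sum4_one sum2_one sum4_map sum4_outer[simplified] comult_one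
  show "tensor_map 4 [incl, incl, \<Delta>] (tensor_one 3) = tensor_one 4"
  proof (rule tensor4_eqI)
    fix g assume g: "ml4 g"
    note [simp] = ml4_comp[OF g] ml_simps
    show "sum4 (tensor_map 4 [incl, incl, \<Delta>] (tensor_one 3)) g = sum4 (tensor_one 4) g" by simp
  qed simp_all
  show "tensor_map 4 [incl, \<Delta>, incl] (tensor_one 3) = tensor_one 4"
  proof (rule tensor4_eqI)
    fix g assume g: "ml4 g"
    note [simp] = ml4_comp[OF g] ml_simps
    show "sum4 (tensor_map 4 [incl, \<Delta>, incl] (tensor_one 3)) g = sum4 (tensor_one 4) g" by simp
  qed simp_all
  show "tensor_outer 4 (tensor_one 3) (tensor_one 1) = tensor_one 4"
  proof (rule tensor4_eqI)
    fix g assume g: "ml4 g"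
    note [simp] = ml4_comp[OF g] ml_simps
    show "sum4 (tensor_outer 4 (tensor_one 3) (tensor_one 1)) g = sum4 (tensor_one 4) g" by simp
  qed simp_all
qed

text \<open>The pentagon is solved for \<open>(\<Delta> \<otimes> id \<otimes> id)(\<Phi>)(\<Phi>\<^sup>-\<^sup>1 \<otimes> 1)\<close> because \<open>u\<close> is a sum over \<open>\<Phi>\<^sup>-\<^sup>1\<close> in the first
  three legs, and in \<open>pentagon_right\<close> for \<open>(id \<otimes> id \<otimes> \<Delta>)(\<Phi>\<^sup>-\<^sup>1)(1 \<otimes> \<Phi>)\<close> because \<open>w\<close> is a sum over \<open>\<Phi>\<close> in the
  last three. The factors carrying coproducts are those that the antipode axioms absorb.\<close>

lemma pentagon_left:
  "tensor_map 4 [\<Delta>, incl, incl] \<Phi> \<odot>\<^bsub>4\<^esub> tensor_outer 4 \<psi> (tensor_one 1) =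
   tensor_map 4 [incl, incl, \<Delta>] \<psi> \<odot>\<^bsub>4\<^esub> tensor_outer 4 (tensor_one 1) \<Phi> \<odot>\<^bsub>4\<^esub> tensor_map 4 [incl, \<Delta>, incl] \<Phi>"
  (is "?T5 \<odot>\<^bsub>4\<^esub> ?T3' = ?T4' \<odot>\<^bsub>4\<^esub> ?T1 \<odot>\<^bsub>4\<^esub> ?T2")
proof -
  let ?T3 = "tensor_outer 4 \<Phi> (tensor_one 1)" and ?T4 = "tensor_map 4 [incl, incl, \<Delta>] \<Phi>"
  have inv: "?T4' \<odot>\<^bsub>4\<^esub> ?T4 = tensor_one 4" "?T3 \<odot>\<^bsub>4\<^esub> ?T3' = tensor_one 4"
    by (simp_all add: reassociator_inv tensor_map_unit[simplified]
        flip: tensor_map_algebra_hom[simplified])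
  have closed: "?T5 \<in> tensor_power 4" "?T3' \<in> tensor_power 4" "?T4' \<in> tensor_power 4"
    "?T1 \<in> tensor_power 4" "?T2 \<in> tensor_power 4" "?T3 \<in> tensor_power 4" "?T4 \<in> tensor_power 4"
    by simp_all
  have "?T5 \<odot>\<^bsub>4\<^esub> ?T3' = (?T4' \<odot>\<^bsub>4\<^esub> ?T4) \<odot>\<^bsub>4\<^esub> (?T5 \<odot>\<^bsub>4\<^esub> ?T3')"
    unfolding inv using closed by (simp only: tensor_mult_one tensor_mult_closed zero_less_numeral)
  also have "\<dots> = ?T4' \<odot>\<^bsub>4\<^esub> (?T4 \<odot>\<^bsub>4\<^esub> ?T5) \<odot>\<^bsub>4\<^esub> ?T3'"
    using closed by (simp only: tensor_mult_assoc tensor_mult_closed zero_less_numeral)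
  also have "\<dots> = ?T4' \<odot>\<^bsub>4\<^esub> (?T1 \<odot>\<^bsub>4\<^esub> ?T2 \<odot>\<^bsub>4\<^esub> ?T3) \<odot>\<^bsub>4\<^esub> ?T3'"
    unfolding pentagon ..
  also have "\<dots> = ?T4' \<odot>\<^bsub>4\<^esub> ?T1 \<odot>\<^bsub>4\<^esub> ?T2 \<odot>\<^bsub>4\<^esub> (?T3 \<odot>\<^bsub>4\<^esub> ?T3')"
    using closed by (simp only: tensor_mult_assoc tensor_mult_closed zero_less_numeral)
  also have "\<dots> = ?T4' \<odot>\<^bsub>4\<^esub> ?T1 \<odot>\<^bsub>4\<^esub> ?T2"
    unfolding inv using closed by (simp only: tensor_mult_one tensor_mult_closed zero_less_numeral)
  finally show ?thesis .
qed

lemma pentagon_right: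
  "tensor_map 4 [incl, incl, \<Delta>] \<psi> \<odot>\<^bsub>4\<^esub> tensor_outer 4 (tensor_one 1) \<Phi> =
   tensor_map 4 [\<Delta>, incl, incl] \<Phi> \<odot>\<^bsub>4\<^esub> tensor_outer 4 \<psi> (tensor_one 1) \<odot>\<^bsub>4\<^esub> tensor_map 4 [incl, \<Delta>, incl] \<psi>"
  (is "?T4' \<odot>\<^bsub>4\<^esub> ?T1 = ?T5 \<odot>\<^bsub>4\<^esub> ?T3' \<odot>\<^bsub>4\<^esub> ?T2'")
proof -
  let ?T2 = "tensor_map 4 [incl, \<Delta>, incl] \<Phi>"
  have inv: "?T2 \<odot>\<^bsub>4\<^esub> ?T2' = tensor_one 4"
    by (simp add: reassociator_inv tensor_map_unit flip: tensor_map_algebra_hom)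
  have closed: "?T4' \<in> tensor_power 4" "?T1 \<in> tensor_power 4" "?T2 \<in> tensor_power 4"
    "?T2' \<in> tensor_power 4"
    by simp_all
  have "?T5 \<odot>\<^bsub>4\<^esub> ?T3' \<odot>\<^bsub>4\<^esub> ?T2' = ?T4' \<odot>\<^bsub>4\<^esub> ?T1 \<odot>\<^bsub>4\<^esub> ?T2 \<odot>\<^bsub>4\<^esub> ?T2'"
    unfolding pentagon_left ..
  also have "\<dots> = ?T4' \<odot>\<^bsub>4\<^esub> ?T1 \<odot>\<^bsub>4\<^esub> (?T2 \<odot>\<^bsub>4\<^esub> ?T2')"
    using closed by (simp only: tensor_mult_assoc tensor_mult_closed zero_less_numeral)
  also have "\<dots> = ?T4' \<odot>\<^bsub>4\<^esub> ?T1"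
    unfolding inv using closed by (simp only: tensor_mult_one tensor_mult_closed zero_less_numeral)
  finally show ?thesis ..
qed

lemma coassoc_sum:
  assumes g: "ml3 g"
  shows "sum2 (\<Delta> h) (\<lambda>h1 h2. sum2 (\<Delta> h2) (\<lambda>a b. sum3 \<Phi> (\<lambda>X1 X2 X3. g (h1 * X1) (a * X2) (b * X3)))) =
      sum3 \<Phi> (\<lambda>X1 X2 X3. sum2 (\<Delta> h) (\<lambda>h1 h2. sum2 (\<Delta> h1) (\<lambda>a b. g (X1 * a) (X2 * b) (X3 * h2))))"
    and "sum3 \<psi> (\<lambda>x1 x2 x3. sum2 (\<Delta> h) (\<lambda>h1 h2. sum2 (\<Delta> h2) (\<lambda>a b. g (x1 * h1) (x2 * a) (x3 * b)))) =
      sum2 (\<Delta> h) (\<lambda>h1 h2. sum2 (\<Delta> h1) (\<lambda>a b. sum3 \<psi> (\<lambda>x1 x2 x3. g (a * x1) (b * x2) (h2 * x3))))"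
proof -
  let ?L = "tensor_map 3 [incl, \<Delta>] (\<Delta> h)" and ?D = "tensor_map 3 [\<Delta>, incl] (\<Delta> h)"
  have closed: "?L \<in> tensor_power 3" "?D \<in> tensor_power 3" "\<Phi> \<in> tensor_power 3" "\<psi> \<in> tensor_power 3" by simp_all
  have "?L \<odot>\<^bsub>3\<^esub> \<Phi> = \<Phi> \<odot>\<^bsub>3\<^esub> ?D \<odot>\<^bsub>3\<^esub> (\<psi> \<odot>\<^bsub>3\<^esub> \<Phi>)"
    using closed unfolding quasi_coassoc by (simp only: tensor_mult_assoc tensor_mult_closed zero_less_numeral)
  also have "\<dots> = \<Phi> \<odot>\<^bsub>3\<^esub> ?D"
    using closed unfolding reassociator_inv by (simp only: tensor_mult_one tensor_mult_closed zero_less_numeral)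
  finally have 1: "?L \<odot>\<^bsub>3\<^esub> \<Phi> = \<Phi> \<odot>\<^bsub>3\<^esub> ?D" .
  have "\<psi> \<odot>\<^bsub>3\<^esub> ?L = (\<psi> \<odot>\<^bsub>3\<^esub> \<Phi>) \<odot>\<^bsub>3\<^esub> (?D \<odot>\<^bsub>3\<^esub> \<psi>)"
    using closed unfolding quasi_coassoc by (simp only: tensor_mult_assoc tensor_mult_closed zero_less_numeral)
  also have "\<dots> = ?D \<odot>\<^bsub>3\<^esub> \<psi>"
    using closed unfolding reassociator_inv by (simp only: tensor_mult_one tensor_mult_closed zero_less_numeral)
  finally have 2: "\<psi> \<odot>\<^bsub>3\<^esub> ?L = ?D \<odot>\<^bsub>3\<^esub> \<psi>" .
  note [simp] = ml3_comp[OF g] ml_simps sum3_mult sum3_map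
  show "sum2 (\<Delta> h) (\<lambda>h1 h2. sum2 (\<Delta> h2) (\<lambda>a b. sum3 \<Phi> (\<lambda>X1 X2 X3. g (h1 * X1) (a * X2) (b * X3)))) =
      sum3 \<Phi> (\<lambda>X1 X2 X3. sum2 (\<Delta> h) (\<lambda>h1 h2. sum2 (\<Delta> h1) (\<lambda>a b. g (X1 * a) (X2 * b) (X3 * h2))))"
    using arg_cong[OF 1, of "\<lambda>A. sum3 A g"] by simp
  show "sum3 \<psi> (\<lambda>x1 x2 x3. sum2 (\<Delta> h) (\<lambda>h1 h2. sum2 (\<Delta> h2) (\<lambda>a b. g (x1 * h1) (x2 * a) (x3 * b)))) =
      sum2 (\<Delta> h) (\<lambda>h1 h2. sum2 (\<Delta> h1) (\<lambda>a b. sum3 \<psi> (\<lambda>x1 x2 x3. g (a * x1) (b * x2) (h2 * x3))))"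
    using arg_cong[OF 2, of "\<lambda>A. sum3 A g"] by simp
qed

lemma pentagon_sum:
  assumes g: "ml4 g"
  shows "sum3 \<Phi> (\<lambda>X1 X2 X3. sum3 \<Phi> (\<lambda>Y1 Y2 Y3. sum2 (\<Delta> Y2) (\<lambda>r s. sum3 \<Phi> (\<lambda>Z1 Z2 Z3.
        g (Y1 * Z1) (X1 * r * Z2) (X2 * s * Z3) (X3 * Y3))))) =
      sum3 \<Phi> (\<lambda>X1 X2 X3. sum2 (\<Delta> X3) (\<lambda>p q. sum3 \<Phi> (\<lambda>Y1 Y2 Y3. sum2 (\<Delta> Y1) (\<lambda>r s.
        g (X1 * r) (X2 * s) (p * Y2) (q * Y3)))))"
    and "sum3 \<Phi> (\<lambda>Y1 Y2 Y3. sum2 (\<Delta> Y1) (\<lambda>r s. sum3 \<psi> (\<lambda>x1 x2 x3.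
        g (r * x1) (s * x2) (Y2 * x3) Y3))) =
      sum3 \<psi> (\<lambda>x1 x2 x3. sum2 (\<Delta> x3) (\<lambda>p q. sum3 \<Phi> (\<lambda>X1 X2 X3.
        sum3 \<Phi> (\<lambda>Y1 Y2 Y3. sum2 (\<Delta> Y2) (\<lambda>r s.
        g (x1 * Y1) (x2 * X1 * r) (p * X2 * s) (q * X3 * Y3))))))"
    and "sum3 \<psi> (\<lambda>x1 x2 x3. sum2 (\<Delta> x3) (\<lambda>p q. sum3 \<Phi> (\<lambda>X1 X2 X3.
        g x1 (x2 * X1) (p * X2) (q * X3)))) =
      sum3 \<Phi> (\<lambda>Y1 Y2 Y3. sum2 (\<Delta> Y1) (\<lambda>r s. sum3 \<psi> (\<lambda>x1 x2 x3.
        sum3 \<psi> (\<lambda>y1 y2 y3. sum2 (\<Delta> y2) (\<lambda>p q.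
        g (r * x1 * y1) (s * x2 * p) (Y2 * x3 * q) (Y3 * y3))))))"
  using arg_cong[OF pentagon, of "\<lambda>A. sum4 A g"] arg_cong[OF pentagon_left, of "\<lambda>A. sum4 A g"]
    arg_cong[OF pentagon_right, of "\<lambda>A. sum4 A g"]
  by (simp_all add: ml4_comp[OF g] ml_simps sum4_mult sum4_map sum4_outer[simplified] g)

section \<open>The counit and the reassociator\<close>

lemma counit_mid:
  assumes "ml2 g"
  shows "sum3 \<Phi> (\<lambda>a b c. \<epsilon> b *s g a c) = g 1 1"
proof -
  have "lin_ext fscale (\<lambda>w. fscale (\<epsilon> (w ! 1)) (word [w ! 0, w ! 2])) (rep \<Phi>) \<in> free_words 2"
    by (intro lin_ext_free_words) (auto simp: free_words_def in_keys_iff lookup_single when_def split: if_splits)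
  moreover have "multilinear 2 (\<lambda>w. g (w ! 0) (w ! 1))"
    using assms by (simp add: multilinear_2 del: One_nat_def)
  moreover have scl: "lin_ext scale h (fscale c p) = c *s lin_ext scale h p" for h c p
    using linear_lin_ext[OF vector_space_axioms, of h] by (simp add: Vector_Spaces.linear_iff)
  ultimately have "sum2 (tensor_class 2 (wsum3 \<Phi> (\<lambda>X1 X2 X3. fscale (\<epsilon> X2) (word [X1, X3])))) g
      = sum3 \<Phi> (\<lambda>a b c. \<epsilon> b *s g a c)"
    unfolding sum2_def sum3_def sweedler_def[of fscale]
    by (simp add: ev_class lin_ext_lin_ext vector_space_axioms)
      (simp add: sweedler_def scl vector_space_axioms)
  then show ?thesis
    unfolding reassociator_counit using assms by (simp add: sum2_one)
qed

lemma reassociator_inv_sum: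
  assumes "ml3 g"
  shows "sum3 \<Phi> (\<lambda>X1 X2 X3. sum3 \<psi> (\<lambda>x1 x2 x3. g (X1 * x1) (X2 * x2) (X3 * x3))) = g 1 1 1"
  using assms by (simp flip: sum3_mult add: reassociator_inv sum3_one)

lemma counit_mid_inv:
  assumes g: "ml2 g"
  shows "sum3 \<psi> (\<lambda>a b c. \<epsilon> b *s g a c) = g 1 1"
proof -
  note [simp] = ml2_comp[OF g] ml_simps
  have "g 1 1 = sum3 \<Phi> (\<lambda>X1 X2 X3. sum3 \<psi> (\<lambda>x1 x2 x3. \<epsilon> (X2 * x2) *s g (X1 * x1) (X3 * x3)))"
    by (simp add: reassociator_inv_sum[where g = "\<lambda>a b c. \<epsilon> b *s g a c"] counit_one)
  also have "\<dots> = sum3 \<Phi> (\<lambda>X1 X2 X3. \<epsilon> X2 *s sum3 \<psi> (\<lambda>x1 x2 x3. \<epsilon> x2 *s g (X1 * x1) (X3 * x3)))"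
    by (simp add: counit_mult sum3_lin[of "\<lambda>x. _ *s x"])
  also have "\<dots> = sum3 \<psi> (\<lambda>a b c. \<epsilon> b *s g a c)"
    by (simp add: counit_mid[where g = "\<lambda>a c. sum3 \<psi> (\<lambda>x1 x2 x3. \<epsilon> x2 *s g (a * x1) (c * x3))"])
  finally show ?thesis ..
qed

text \<open>Write \<open>e = (\<epsilon> \<otimes> id \<otimes> id)(\<Phi>)\<close>. Applying \<open>\<epsilon> \<otimes> \<epsilon> \<otimes> id \<otimes> id\<close> to the pentagon and using
  \<open>counit_mid\<close> gives \<open>ee = e\<close>, and \<open>e\<close> is invertible with inverse \<open>(\<epsilon> \<otimes> id \<otimes> id)(\<Phi>\<^sup>-\<^sup>1)\<close>, so \<open>e = 1 \<otimes> 1\<close>.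
  In the proof \<open>G\<close> is \<open>g\<close> precomposed with right multiplication by this inverse.\<close>

lemma counit_first:
  assumes g: "ml2 g"
  shows "sum3 \<Phi> (\<lambda>a b c. \<epsilon> a *s g b c) = g 1 1"
proof -
  note [simp] = ml2_comp[OF g] ml_simps
  define G where "G c d = sum3 \<psi> (\<lambda>x y z. \<epsilon> x *s g (c * y) (d * z))" for c d
  have G: "ml2 G" by (simp add: G_def)
  note [simp] = ml2_comp[OF G]
  define F where "F a b c d = \<epsilon> a *s (\<epsilon> b *s G c d)" for a b c d
  have F: "ml4 F" by (simp add: F_def)
  have G_sum: "sum3 \<Phi> (\<lambda>a b c. \<epsilon> a *s G (p * b) (q * c)) = g p q" for p q
    using reassociator_inv_sum[of "\<lambda>a b c. \<epsilon> a *s g (p * b) (q * c)"]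
    by (simp add: G_def counit_mult counit_one sum3_lin[of "\<lambda>x. _ *s x"] mult.assoc)
  have lhs: "sum2 (\<Delta> Y2) (\<lambda>r s. sum3 \<Phi> (\<lambda>Z1 Z2 Z3. F (Y1 * Z1) (X1 * r * Z2) (X2 * s * Z3) (X3 * Y3)))
      = \<epsilon> X1 *s (\<epsilon> Y1 *s G (X2 * Y2) (X3 * Y3))" for X1 X2 X3 Y1 Y2 Y3
  proof -
    have "sum3 \<Phi> (\<lambda>Z1 Z2 Z3. F (Y1 * Z1) (X1 * r * Z2) (X2 * s * Z3) (X3 * Y3))
        = sum3 \<Phi> (\<lambda>Z1 Z2 Z3. \<epsilon> Z2 *s F (Y1 * Z1) (X1 * r) (X2 * s * Z3) (X3 * Y3))" for r s
      by (simp add: F_def counit_mult mult_ac)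
    also have "\<dots> r s = F Y1 (X1 * r) (X2 * s) (X3 * Y3)" for r s
      using counit_mid[of "\<lambda>a c. F (Y1 * a) (X1 * r) (X2 * s * c) (X3 * Y3)"]
      by (simp add: ml4_comp[OF F])
    also have "\<dots> r s = \<epsilon> r *s (\<epsilon> X1 *s \<epsilon> Y1 *s G (X2 * s) (X3 * Y3))" for r s
      by (simp add: F_def counit_mult mult_ac)
    finally show ?thesis
      by (simp only: sum_comult_counit_left[of "\<lambda>s. \<epsilon> X1 *s \<epsilon> Y1 *s G (X2 * s) (X3 * Y3)"] ml_simps ml2_comp[OF G])
  qed
  have rhs: "sum3 \<Phi> (\<lambda>Y1 Y2 Y3. sum2 (\<Delta> Y1) (\<lambda>r s. F (X1 * r) (X2 * s) (p * Y2) (q * Y3)))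
      = \<epsilon> X2 *s (\<epsilon> X1 *s g p q)" for X1 X2 p q
  proof -
    have "sum2 (\<Delta> Y1) (\<lambda>r s. F (X1 * r) (X2 * s) (p * Y2) (q * Y3))
        = sum2 (\<Delta> Y1) (\<lambda>r s. \<epsilon> r *s (\<epsilon> s *s (\<epsilon> X1 * \<epsilon> X2) *s G (p * Y2) (q * Y3)))" for Y1 Y2 Y3
      by (simp add: F_def counit_mult mult_ac)
    also have "\<dots> Y1 Y2 Y3 = \<epsilon> Y1 *s ((\<epsilon> X1 * \<epsilon> X2) *s G (p * Y2) (q * Y3))" for Y1 Y2 Y3
      by (rule sum_comult_counit_left) simp
    also have "\<dots> Y1 Y2 Y3 = (\<epsilon> X1 * \<epsilon> X2) *s (\<epsilon> Y1 *s G (p * Y2) (q * Y3))" for Y1 Y2 Y3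
      by (simp add: mult_ac)
    finally have "sum3 \<Phi> (\<lambda>Y1 Y2 Y3. sum2 (\<Delta> Y1) (\<lambda>r s. F (X1 * r) (X2 * s) (p * Y2) (q * Y3)))
        = (\<epsilon> X1 * \<epsilon> X2) *s g p q"
      by (simp only: G_sum sum3_lin[of "\<lambda>x. _ *s x", symmetric] ml_simps)
    then show ?thesis by (simp add: mult.commute)
  qed
  have "sum3 \<Phi> (\<lambda>X1 X2 X3. \<epsilon> X1 *s g X2 X3) =
      sum3 \<Phi> (\<lambda>X1 X2 X3. sum3 \<Phi> (\<lambda>Y1 Y2 Y3. \<epsilon> X1 *s (\<epsilon> Y1 *s G (X2 * Y2) (X3 * Y3))))"
    by (simp only: G_sum sum3_lin[of "\<lambda>x. _ *s x", symmetric] ml_simps)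
  also have "\<dots> = sum3 \<Phi> (\<lambda>X1 X2 X3. sum2 (\<Delta> X3) (\<lambda>p q. \<epsilon> X2 *s (\<epsilon> X1 *s g p q)))"
    using pentagon_sum(1)[OF F] unfolding lhs rhs .
  also have "\<dots> = sum3 \<Phi> (\<lambda>X1 X2 X3. \<epsilon> X2 *s (\<epsilon> X1 *s sum2 (\<Delta> X3) g))"
    by (simp only: sum2_lin[of "\<lambda>x. _ *s x", symmetric] ml_simps)
  also have "\<dots> = \<epsilon> 1 *s sum2 (\<Delta> 1) g"
    by (rule counit_mid) simp
  also have "\<dots> = g 1 1"
    by (simp add: counit_one comult_one sum2_one)
  finally show ?thesis .
qed

text \<open>The mirror image of the previous argument: with \<open>e = (id \<otimes> id \<otimes> \<epsilon>)(\<Phi>)\<close> the map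
  \<open>id \<otimes> id \<otimes> \<epsilon> \<otimes> \<epsilon>\<close> turns the pentagon into \<open>ee = e\<close>. Multiplying twice by \<open>e\<^sup>-\<^sup>1\<close>, once in \<open>G\<close>
  and once more in \<open>H\<close>, yields \<open>e\<^sup>-\<^sup>1 = 1 \<otimes> 1\<close>.\<close>

lemma counit_last_inv:
  assumes g: "ml2 g"
  shows "sum3 \<psi> (\<lambda>a b c. \<epsilon> c *s g a b) = g 1 1"
proof -
  note [simp] = ml2_comp[OF g] ml_simps
  define G where "G c d = sum3 \<psi> (\<lambda>x y z. \<epsilon> z *s g (c * x) (d * y))" for c d
  have G: "ml2 G" by (simp add: G_def)
  note [simp] = ml2_comp[OF G]
  define H where "H c d = sum3 \<psi> (\<lambda>x y z. \<epsilon> z *s G (c * x) (d * y))" for c d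
  have H: "ml2 H" by (simp add: H_def)
  note [simp] = ml2_comp[OF H]
  define F where "F a b c d = \<epsilon> c *s (\<epsilon> d *s H a b)" for a b c d
  have F: "ml4 F" by (simp add: F_def)
  have G_sum: "sum3 \<Phi> (\<lambda>a b c. \<epsilon> c *s G (p * a) (q * b)) = g p q" for p q
    using reassociator_inv_sum[of "\<lambda>a b c. \<epsilon> c *s g (p * a) (q * b)"]
    by (simp add: G_def counit_mult counit_one sum3_lin[of "\<lambda>x. _ *s x"] mult.assoc)
  have H_sum: "sum3 \<Phi> (\<lambda>a b c. \<epsilon> c *s H (p * a) (q * b)) = G p q" for p q
    using reassociator_inv_sum[of "\<lambda>a b c. \<epsilon> c *s G (p * a) (q * b)"]
    by (simp add: H_def counit_mult counit_one sum3_lin[of "\<lambda>x. _ *s x"] mult.assoc)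
  have lhs: "sum2 (\<Delta> Y2) (\<lambda>r s. sum3 \<Phi> (\<lambda>Z1 Z2 Z3. F (Y1 * Z1) (X1 * r * Z2) (X2 * s * Z3) (X3 * Y3)))
      = \<epsilon> X2 *s (\<epsilon> X3 *s (\<epsilon> Y3 *s G Y1 (X1 * Y2)))" for X1 X2 X3 Y1 Y2 Y3
  proof -
    have "sum3 \<Phi> (\<lambda>Z1 Z2 Z3. F (Y1 * Z1) (X1 * r * Z2) (X2 * s * Z3) (X3 * Y3))
        = sum3 \<Phi> (\<lambda>Z1 Z2 Z3. \<epsilon> s *s (\<epsilon> X2 * \<epsilon> X3 * \<epsilon> Y3) *s (\<epsilon> Z3 *s H (Y1 * Z1) (X1 * r * Z2)))" for r s
      by (simp add: F_def counit_mult mult_ac)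
    also have "\<dots> r s = \<epsilon> s *s ((\<epsilon> X2 * \<epsilon> X3 * \<epsilon> Y3) *s G Y1 (X1 * r))" for r s
      by (simp only: H_sum sum3_lin[of "\<lambda>x. _ *s x", symmetric] ml_simps)
    finally show ?thesis
      using sum_comult_counit_right[of "\<lambda>r. (\<epsilon> X2 * \<epsilon> X3 * \<epsilon> Y3) *s G Y1 (X1 * r)"]
      by (simp add: mult_ac)
  qed
  have rhs: "sum2 (\<Delta> X3) (\<lambda>p q. sum3 \<Phi> (\<lambda>Y1 Y2 Y3. sum2 (\<Delta> Y1) (\<lambda>r s. F (X1 * r) (X2 * s) (p * Y2) (q * Y3))))
      = \<epsilon> X3 *s H X1 X2" for X1 X2 X3
  proof -
    have "sum3 \<Phi> (\<lambda>Y1 Y2 Y3. sum2 (\<Delta> Y1) (\<lambda>r s. F (X1 * r) (X2 * s) (p * Y2) (q * Y3)))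
        = sum3 \<Phi> (\<lambda>Y1 Y2 Y3. \<epsilon> Y2 *s sum2 (\<Delta> Y1) (\<lambda>r s. F (X1 * r) (X2 * s) p (q * Y3)))" for p q
      by (simp only: sum2_lin[of "\<lambda>x. _ *s x"] ml_simps) (simp add: F_def counit_mult mult_ac)
    also have "\<dots> p q = sum2 (\<Delta> 1) (\<lambda>r s. F (X1 * r) (X2 * s) p (q * 1))" for p q
      by (rule counit_mid) (simp add: ml4_comp[OF F])
    also have "\<dots> p q = \<epsilon> p *s (\<epsilon> q *s H X1 X2)" for p q
      using F by (simp add: comult_one sum2_one ml4_comp[OF F]) (simp add: F_def)
    finally show ?thesis
      using sum_comult_counit_left[of "\<lambda>q. \<epsilon> q *s H X1 X2"] by (simp del: scale_scale)
  qed
  have "sum3 \<psi> (\<lambda>a b c. \<epsilon> c *s g a b) = G 1 1"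
    by (simp add: G_def)
  also have "\<dots> = sum3 \<Phi> (\<lambda>a b c. \<epsilon> c *s H a b)"
    using H_sum[of 1 1] by simp
  also have "\<dots> = sum3 \<Phi> (\<lambda>X1 X2 X3. sum3 \<Phi> (\<lambda>Y1 Y2 Y3. \<epsilon> X2 *s (\<epsilon> X3 *s (\<epsilon> Y3 *s G Y1 (X1 * Y2)))))"
    using pentagon_sum(1)[OF F] unfolding lhs rhs ..
  also have "\<dots> = sum3 \<Phi> (\<lambda>X1 X2 X3. \<epsilon> X2 *s (\<epsilon> X3 *s g 1 X1))"
    using G_sum[of 1] by (simp only: sum3_lin[of "\<lambda>x. _ *s x", symmetric] ml_simps mult_1)
  also have "\<dots> = \<epsilon> 1 *s g 1 1"
    by (rule counit_mid) simp
  finally show ?thesis by (simp add: counit_one)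
qed

end

context quasi_hopf_algebra
begin

section \<open>Invariant forms and maps to the double dual\<close>

lemma lin_antipode: "lin f \<Longrightarrow> lin (\<lambda>x. S (f x))"
  using antipode_linear by (simp add: lin_def Vector_Spaces.linear_iff)

lemmas multilinear_simps = ml_simps lin_antipode

text \<open>Lets the antipode axioms and the invariance of a form be applied inside a larger product.\<close>

lemma sum_comult_lin:
  assumes "sum2 (\<Delta> h) f = \<epsilon> h *s m" "lin F"
  shows "sum2 (\<Delta> h) (\<lambda>a b. F (f a b)) = \<epsilon> h *s F m"
  using assms by (simp flip: sum2_lin) (simp add: lin_def)

lemma antipode_left_sum: "sum2 (\<Delta> h) (\<lambda>a b. S a * \<alpha> * b) = \<epsilon> h *s \<alpha>"
  and antipode_right_sum: "sum2 (\<Delta> h) (\<lambda>a b. a * \<beta> * S b) = \<epsilon> h *s \<beta>"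
  using antipode_left antipode_right by (simp_all add: sum2_def)

lemma antipode_reassociator_sum: "sum3 \<Phi> (\<lambda>X1 X2 X3. X1 * \<beta> * S X2 * \<alpha> * X3) = 1"
  and antipode_reassociator_inv_sum: "sum3 \<psi> (\<lambda>x1 x2 x3. S x1 * \<alpha> * x2 * \<beta> * S x3) = 1"
  using antipode_reassociator antipode_reassociator_inv by (simp_all add: sum3_def)

text \<open>If \<open>m\<close> satisfies \<open>S(h\<^sub>2)mh\<^sub>1 = \<epsilon>(h)m\<close>, then it is an invariant form \<open>V \<otimes> V\<^sup>* \<rightarrow> k\<close>, and \<open>double_dual_map m\<close> is the
  map \<open>V \<rightarrow> V \<otimes> (V\<^sup>* \<otimes> V\<^sup>*\<^sup>*) \<rightarrow> (V \<otimes> V\<^sup>*) \<otimes> V\<^sup>*\<^sup>* \<rightarrow> V\<^sup>*\<^sup>*\<close> made of the coevaluation of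
  \<open>V\<^sup>*\<close>, the associator and the form.\<close>

definition double_dual_map :: "'h \<Rightarrow> 'h" where
  "double_dual_map m = sum3 \<psi> (\<lambda>x1 x2 x3. S (x2 * \<beta> * S x3) * m * x1)"

text \<open>In the opposite direction, \<open>n\<close> with \<open>S(h\<^sub>1)nS\<^sup>2(h\<^sub>2) = \<epsilon>(h)n\<close> is an invariant form \<open>V\<^sup>* \<otimes> V\<^sup>*\<^sup>* \<rightarrow> k\<close>, and
  \<open>double_dual_comap n\<close> is the map \<open>V\<^sup>*\<^sup>* \<rightarrow> (V \<otimes> V\<^sup>*) \<otimes> V\<^sup>*\<^sup>* \<rightarrow> V \<otimes> (V\<^sup>* \<otimes> V\<^sup>*\<^sup>*) \<rightarrow> V\<close> made of the
  coevaluation of \<open>V\<close>, the associator and the form.\<close>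

definition double_dual_comap :: "'h \<Rightarrow> 'h" where
  "double_dual_comap n = sum3 \<Phi> (\<lambda>X1 X2 X3. X1 * \<beta> * S X2 * n * S (S X3))"

context
  fixes m
  assumes m: "\<And>h. sum2 (\<Delta> h) (\<lambda>a b. S b * m * a) = \<epsilon> h *s m"
begin

text \<open>Evaluate quasi-coassociativity on \<open>a \<otimes> b \<otimes> c \<mapsto> S(b\<beta>S(c))ma\<close>: on one side the last two legs collapse by the
  antipode axiom for \<open>\<beta>\<close>, on the other side the first two by the invariance of \<open>m\<close>.\<close>

lemma double_dual_map_intertwines: "S (S h) * double_dual_map m = double_dual_map m * h"
proof -
  note [simp] = multilinear_simps
  define g where "g a b c = S (b * \<beta> * S c) * m * a" for a b c
  have g: "ml3 g" by (simp add: g_def)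
  have left: "sum2 (\<Delta> h) (\<lambda>h1 h2. sum2 (\<Delta> h2) (\<lambda>a b. g (x1 * h1) (x2 * a) (x3 * b))) = g x1 x2 x3 * h"
    for x1 x2 x3
  proof -
    have "sum2 (\<Delta> h2) (\<lambda>a b. g (x1 * h1) (x2 * a) (x3 * b)) = \<epsilon> h2 *s (g x1 x2 x3 * h1)" for h1 h2
      using sum_comult_lin[OF antipode_right_sum, of "\<lambda>t. S (x2 * t * S x3) * m * (x1 * h1)"]
      by (simp add: g_def antipode_mult mult.assoc)
    then show ?thesis
      using sum_comult_counit_right[of "\<lambda>h1. g x1 x2 x3 * h1"] by simp
  qed
  have right: "sum2 (\<Delta> h) (\<lambda>h1 h2. sum2 (\<Delta> h1) (\<lambda>a b. g (a * x1) (b * x2) (h2 * x3))) = S (S h) * g x1 x2 x3"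
    for x1 x2 x3
  proof -
    have "sum2 (\<Delta> h1) (\<lambda>a b. g (a * x1) (b * x2) (h2 * x3)) = \<epsilon> h1 *s (S (S h2) * g x1 x2 x3)" for h1 h2
      using sum_comult_lin[OF m, of "\<lambda>t. S (x2 * \<beta> * S (h2 * x3)) * t * x1"]
      by (simp add: g_def antipode_mult mult.assoc)
    then show ?thesis
      using sum_comult_counit_left[of "\<lambda>h2. S (S h2) * g x1 x2 x3"] by simp
  qed
  have "double_dual_map m * h = sum3 \<psi> (\<lambda>x1 x2 x3. g x1 x2 x3 * h)"
    by (simp add: double_dual_map_def g_def sum3_lin[of "\<lambda>x. x * h"])
  also have "\<dots> = sum3 \<psi> (\<lambda>x1 x2 x3. S (S h) * g x1 x2 x3)"
    using coassoc_sum(2)[OF g, of h] by (simp add: left right sum2_sum3_swap)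
  also have "\<dots> = S (S h) * double_dual_map m"
    by (simp add: double_dual_map_def g_def sum3_lin[of "\<lambda>x. S (S h) * x"])
  finally show ?thesis ..
qed

text \<open>A zigzag identity: applying the evaluation after \<open>double_dual_map m\<close> straightens the coevaluation and leaves \<open>m\<close>.
  Both sides of \<open>pentagon_left\<close> are evaluated on \<open>a \<otimes> b \<otimes> c \<otimes> d \<mapsto> S(b\<beta>S(c)\<alpha>d)ma\<close>. Each coproduct that
  occurs is absorbed by the invariance of \<open>m\<close> or by an antipode axiom, which leaves a counit on the corresponding leg of
  the reassociator.\<close>

lemma antipode_alpha_double_dual_map: "S \<alpha> * double_dual_map m = m"
proof -
  note [simp] = multilinear_simps
  define g where "g a b c d = S (b * \<beta> * S c * \<alpha> * d) * m * a" for a b c d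
  have g: "ml4 g" by (simp add: g_def)
  have left: "sum3 \<Phi> (\<lambda>Y1 Y2 Y3. sum2 (\<Delta> Y1) (\<lambda>r s. sum3 \<psi> (\<lambda>x1 x2 x3.
      g (r * x1) (s * x2) (Y2 * x3) Y3))) = S \<alpha> * double_dual_map m"
  proof -
    have "sum2 (\<Delta> Y1) (\<lambda>r s. g (r * x1) (s * x2) (Y2 * x3) Y3) = \<epsilon> Y1 *s g x1 x2 (Y2 * x3) Y3"
      for x1 x2 x3 Y1 Y2 Y3
      using sum_comult_lin[OF m, of "\<lambda>t. S (x2 * \<beta> * S (Y2 * x3) * \<alpha> * Y3) * t * x1"]
      by (simp add: g_def antipode_mult mult.assoc)
    moreover have "sum3 \<Phi> (\<lambda>Y1 Y2 Y3. \<epsilon> Y1 *s g x1 x2 (Y2 * x3) Y3) = g x1 x2 x3 1" for x1 x2 x3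
      using counit_first[of "\<lambda>Y2 Y3. g x1 x2 (Y2 * x3) Y3"] by (simp add: ml4_comp[OF g])
    ultimately show ?thesis
      by (simp add: sum2_sum3_swap sum3_sum3_swap[of \<Phi> \<psi>] double_dual_map_def
          sum3_lin[of "\<lambda>x. _ * x"]) (simp add: g_def antipode_mult mult.assoc)
  qed
  have right: "sum2 (\<Delta> x3) (\<lambda>p q. sum3 \<Phi> (\<lambda>X1 X2 X3. sum3 \<Phi> (\<lambda>Y1 Y2 Y3. sum2 (\<Delta> Y2) (\<lambda>r s.
        g (x1 * Y1) (x2 * X1 * r) (p * X2 * s) (q * X3 * Y3))))) = \<epsilon> x3 *s (S x2 * m * x1)"
    for x1 x2 x3
  proof -
    have "sum2 (\<Delta> Y2) (\<lambda>r s. g (x1 * Y1) (x2 * X1 * r) (p * X2 * s) (q * X3 * Y3)) =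
        \<epsilon> Y2 *s g (x1 * Y1) (x2 * X1) (p * X2) (q * X3 * Y3)" for p q X1 X2 X3 Y1 Y2 Y3
      using sum_comult_lin[OF antipode_right_sum,
          of "\<lambda>t. S (x2 * X1 * t * S (p * X2) * \<alpha> * q * X3 * Y3) * m * (x1 * Y1)"]
      by (simp add: g_def antipode_mult mult.assoc)
    moreover have "sum3 \<Phi> (\<lambda>Y1 Y2 Y3. \<epsilon> Y2 *s g (x1 * Y1) (x2 * X1) (p * X2) (q * X3 * Y3)) =
        g x1 (x2 * X1) (p * X2) (q * X3)" for p q X1 X2 X3
      using counit_mid[of "\<lambda>Y1 Y3. g (x1 * Y1) (x2 * X1) (p * X2) (q * X3 * Y3)"]
      by (simp add: ml4_comp[OF g])
    moreover have "sum2 (\<Delta> x3) (\<lambda>p q. g x1 (x2 * X1) (p * X2) (q * X3)) =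
        \<epsilon> x3 *s (S (x2 * (X1 * \<beta> * S X2 * \<alpha> * X3)) * m * x1)" for X1 X2 X3
      using sum_comult_lin[OF antipode_left_sum, of "\<lambda>t. S (x2 * X1 * \<beta> * S X2 * t * X3) * m * x1"]
      by (simp add: g_def antipode_mult mult.assoc)
    moreover have "sum3 \<Phi> (\<lambda>X1 X2 X3. \<epsilon> x3 *s (S (x2 * (X1 * \<beta> * S X2 * \<alpha> * X3)) * m * x1)) =
        \<epsilon> x3 *s (S x2 * m * x1)"
      using sum3_lin[of "\<lambda>t. \<epsilon> x3 *s (S (x2 * t) * m * x1)" \<Phi> "\<lambda>X1 X2 X3. X1 * \<beta> * S X2 * \<alpha> * X3"]
      by (simp add: antipode_reassociator_sum)
    ultimately show ?thesis
      by (simp add: sum2_sum3_swap)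
  qed
  have "S \<alpha> * double_dual_map m = sum3 \<psi> (\<lambda>x1 x2 x3. \<epsilon> x3 *s (S x2 * m * x1))"
    using pentagon_sum(2)[OF g] unfolding left right .
  also have "\<dots> = m"
    using counit_last_inv[of "\<lambda>a b. S b * m * a"] by (simp add: antipode_one)
  finally show ?thesis .
qed

end

context
  fixes n
  assumes n: "\<And>h. sum2 (\<Delta> h) (\<lambda>a b. S a * n * S (S b)) = \<epsilon> h *s n"
begin

text \<open>As for \<open>double_dual_map\<close>, with \<open>a \<otimes> b \<otimes> c \<mapsto> a\<beta>S(b)nS\<^sup>2(c)\<close>.\<close>

lemma double_dual_comap_intertwines: "h * double_dual_comap n = double_dual_comap n * S (S h)"
proof -
  note [simp] = multilinear_simps
  define g where "g a b c = a * \<beta> * S b * n * S (S c)" for a b c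
  have g: "ml3 g" by (simp add: g_def)
  have left: "sum2 (\<Delta> h) (\<lambda>h1 h2. sum2 (\<Delta> h2) (\<lambda>a b. g (h1 * X1) (a * X2) (b * X3))) = h * g X1 X2 X3"
    for X1 X2 X3
  proof -
    have "sum2 (\<Delta> h2) (\<lambda>a b. g (h1 * X1) (a * X2) (b * X3)) = \<epsilon> h2 *s (h1 * g X1 X2 X3)" for h1 h2
      using sum_comult_lin[OF n, of "\<lambda>t. h1 * X1 * \<beta> * S X2 * t * S (S X3)"]
      by (simp add: g_def antipode_mult mult.assoc)
    then show ?thesis
      using sum_comult_counit_right[of "\<lambda>h1. h1 * g X1 X2 X3"] by simp
  qed
  have right: "sum2 (\<Delta> h) (\<lambda>h1 h2. sum2 (\<Delta> h1) (\<lambda>a b. g (X1 * a) (X2 * b) (X3 * h2))) = g X1 X2 X3 * S (S h)"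
    for X1 X2 X3
  proof -
    have "sum2 (\<Delta> h1) (\<lambda>a b. g (X1 * a) (X2 * b) (X3 * h2)) = \<epsilon> h1 *s (g X1 X2 X3 * S (S h2))" for h1 h2
      using sum_comult_lin[OF antipode_right_sum, of "\<lambda>t. X1 * t * S X2 * n * S (S (X3 * h2))"]
      by (simp add: g_def antipode_mult mult.assoc)
    then show ?thesis
      using sum_comult_counit_left[of "\<lambda>h2. g X1 X2 X3 * S (S h2)"] by simp
  qed
  have "h * double_dual_comap n = sum3 \<Phi> (\<lambda>X1 X2 X3. h * g X1 X2 X3)"
    by (simp add: double_dual_comap_def g_def sum3_lin[of "\<lambda>x. h * x"])
  also have "\<dots> = sum3 \<Phi> (\<lambda>X1 X2 X3. g X1 X2 X3 * S (S h))"
    using coassoc_sum(1)[OF g, of h] by (simp add: left right sum2_sum3_swap)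
  also have "\<dots> = double_dual_comap n * S (S h)"
    by (simp add: double_dual_comap_def g_def sum3_lin[of "\<lambda>x. x * S (S h)"])
  finally show ?thesis .
qed

text \<open>The second zigzag identity: evaluate \<open>pentagon_right\<close> on
  \<open>a \<otimes> b \<otimes> c \<otimes> d \<mapsto> S(a)\<alpha>b\<beta>S(c)nS\<^sup>2(d)\<close>. Here the sum over the remaining copy of \<open>\<Phi>\<^sup>-\<^sup>1\<close> is
  \<open>S(x\<^sup>1)\<alpha>x\<^sup>2\<beta>S(x\<^sup>3) = 1\<close>.\<close>

lemma alpha_double_dual_comap: "\<alpha> * double_dual_comap n = n"
proof -
  note [simp] = multilinear_simps
  define g where "g a b c d = S a * \<alpha> * b * \<beta> * S c * n * S (S d)" for a b c d
  have g: "ml4 g" by (simp add: g_def)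
  have left: "sum2 (\<Delta> x3) (\<lambda>p q. sum3 \<Phi> (\<lambda>X1 X2 X3. g x1 (x2 * X1) (p * X2) (q * X3))) =
      \<epsilon> x3 *s (S x1 * \<alpha> * x2 * double_dual_comap n)" for x1 x2 x3
  proof -
    have "sum2 (\<Delta> x3) (\<lambda>p q. g x1 (x2 * X1) (p * X2) (q * X3)) = \<epsilon> x3 *s g x1 (x2 * X1) X2 X3"
      for X1 X2 X3
      using sum_comult_lin[OF n, of "\<lambda>t. S x1 * \<alpha> * x2 * X1 * \<beta> * S X2 * t * S (S X3)"]
      by (simp add: g_def antipode_mult mult.assoc)
    then show ?thesis
      by (simp add: sum2_sum3_swap double_dual_comap_def sum3_lin[of "\<lambda>x. _ * x"]
          sum3_lin[of "\<lambda>x. _ *s x"]) (simp add: g_def mult.assoc)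
  qed
  have right: "sum2 (\<Delta> Y1) (\<lambda>r s. sum3 \<psi> (\<lambda>x1 x2 x3. sum3 \<psi> (\<lambda>y1 y2 y3. sum2 (\<Delta> y2) (\<lambda>p q.
        g (r * x1 * y1) (s * x2 * p) (Y2 * x3 * q) (Y3 * y3))))) =
      \<epsilon> Y1 *s sum3 \<psi> (\<lambda>x1 x2 x3. g x1 x2 (Y2 * x3) Y3)" for Y1 Y2 Y3
  proof -
    have "sum2 (\<Delta> y2) (\<lambda>p q. g (r * x1 * y1) (s * x2 * p) (Y2 * x3 * q) (Y3 * y3)) =
        \<epsilon> y2 *s g (r * x1 * y1) (s * x2) (Y2 * x3) (Y3 * y3)" for r s x1 x2 x3 y1 y2 y3
      using sum_comult_lin[OF antipode_right_sum,
          of "\<lambda>t. S (r * x1 * y1) * \<alpha> * (s * x2) * t * S (Y2 * x3) * n * S (S (Y3 * y3))"]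
      by (simp add: g_def antipode_mult mult.assoc)
    moreover have "sum3 \<psi> (\<lambda>y1 y2 y3. \<epsilon> y2 *s g (r * x1 * y1) (s * x2) (Y2 * x3) (Y3 * y3)) =
        g (r * x1) (s * x2) (Y2 * x3) Y3" for r s x1 x2 x3
      using counit_mid_inv[of "\<lambda>y1 y3. g (r * x1 * y1) (s * x2) (Y2 * x3) (Y3 * y3)"]
      by (simp add: ml4_comp[OF g])
    moreover have "sum2 (\<Delta> Y1) (\<lambda>r s. g (r * x1) (s * x2) (Y2 * x3) Y3) =
        \<epsilon> Y1 *s g x1 x2 (Y2 * x3) Y3" for x1 x2 x3
      using sum_comult_lin[OF antipode_left_sum,
          of "\<lambda>t. S x1 * t * x2 * \<beta> * S (Y2 * x3) * n * S (S Y3)"]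
      by (simp add: g_def antipode_mult mult.assoc)
    ultimately show ?thesis
      by (simp add: sum2_sum3_swap sum3_lin[of "\<lambda>x. _ *s x"])
  qed
  have "\<alpha> * double_dual_comap n = sum3 \<psi> (\<lambda>x1 x2 x3. \<epsilon> x3 *s (S x1 * \<alpha> * x2 * double_dual_comap n))"
    using counit_last_inv[of "\<lambda>a b. S a * \<alpha> * b * double_dual_comap n"] by (simp add: antipode_one)
  also have "\<dots> = sum3 \<Phi> (\<lambda>Y1 Y2 Y3. \<epsilon> Y1 *s sum3 \<psi> (\<lambda>x1 x2 x3. g x1 x2 (Y2 * x3) Y3))"
    using pentagon_sum(3)[OF g] unfolding left right .
  also have "\<dots> = sum3 \<psi> (\<lambda>x1 x2 x3. g x1 x2 (1 * x3) 1)"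
    by (rule counit_first[of "\<lambda>Y2 Y3. sum3 \<psi> (\<lambda>x1 x2 x3. g x1 x2 (Y2 * x3) Y3)"])
      (simp add: ml4_comp[OF g])
  also have "\<dots> = n"
    using sum3_lin[of "\<lambda>t. t * n" \<psi> "\<lambda>x1 x2 x3. S x1 * \<alpha> * x2 * \<beta> * S x3"]
    by (simp add: g_def antipode_one antipode_reassociator_inv_sum)
  finally show ?thesis .
qed

end

section \<open>The counit and the antipode\<close>

lemma sum_0: "sum2 A (\<lambda>a b. 0) = 0" "sum3 A (\<lambda>a b c. 0) = 0"
  by (simp_all add: sum2_def sum3_def sweedler_def lin_ext_def)

lemma one_neq_zero: "(1 :: 'h) \<noteq> 0"
proof
  assume "(1 :: 'h) = 0"
  then have "\<epsilon> 1 = \<epsilon> (0 *s 1)" by simp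
  also have "\<dots> = 0 * \<epsilon> 1"
    using counit_linear unfolding Vector_Spaces.linear_iff by blast
  finally show False by (simp add: counit_one)
qed

text \<open>The counit followed by the unit. The sums take values in \<open>H\<close>, so this linear map, and not \<open>\<epsilon>\<close> itself, can be
  moved into them.\<close>

definition eps :: "'h \<Rightarrow> 'h" where
  "eps h = \<epsilon> h *s 1"

lemma lin_eps: "lin f \<Longrightarrow> lin (\<lambda>x. eps (f x))"
  unfolding eps_def by (rule lin_counit)

lemma eps_inject: "eps a = eps b \<longleftrightarrow> \<epsilon> a = \<epsilon> b"
  by (simp add: eps_def one_neq_zero)

lemma counit_alpha_neq_zero: "\<epsilon> \<alpha> \<noteq> 0"
proof
  assume 0: "\<epsilon> \<alpha> = 0"
  have "eps 1 = sum3 \<Phi> (\<lambda>X1 X2 X3. eps (X1 * \<beta> * S X2 * \<alpha> * X3))"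
    unfolding antipode_reassociator_sum[symmetric] by (rule sum3_lin) (intro lin_eps lin_id)
  then show False
    by (simp add: eps_def counit_mult 0 sum_0 counit_one one_neq_zero)
qed

text \<open>Applying \<open>\<epsilon>\<close> to \<open>S(h\<^sub>1)\<alpha>h\<^sub>2 = \<epsilon>(h)\<alpha>\<close> gives \<open>\<epsilon>(S(h))\<epsilon>(\<alpha>) = \<epsilon>(h)\<epsilon>(\<alpha>)\<close>, and \<open>\<epsilon>(\<alpha>)\<close> can be cancelled.\<close>

lemma counit_antipode: "\<epsilon> (S h) = \<epsilon> h"
proof -
  note [simp] = multilinear_simps lin_eps
  have "(\<epsilon> (S h) * \<epsilon> \<alpha>) *s 1 = sum2 (\<Delta> h) (\<lambda>a b. \<epsilon> b *s ((\<epsilon> (S a) * \<epsilon> \<alpha>) *s 1))"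
    by (subst sum_comult_counit_right) simp_all
  also have "\<dots> = eps (sum2 (\<Delta> h) (\<lambda>a b. S a * \<alpha> * b))"
    by (simp add: sum2_lin[of eps]) (simp add: eps_def counit_mult mult_ac)
  also have "\<dots> = (\<epsilon> h * \<epsilon> \<alpha>) *s 1"
    using counit_linear by (simp add: antipode_left_sum eps_def Vector_Spaces.linear_iff)
  finally show ?thesis by (simp add: one_neq_zero counit_alpha_neq_zero)
qed

lemma counit_beta_alpha: "\<epsilon> \<beta> * \<epsilon> \<alpha> = 1"
proof -
  note [simp] = multilinear_simps lin_eps
  have "eps 1 = eps (sum3 \<Phi> (\<lambda>X1 X2 X3. X1 * \<beta> * S X2 * \<alpha> * X3))"
    by (simp only: antipode_reassociator_sum)
  also have "\<dots> = sum3 \<Phi> (\<lambda>X1 X2 X3. \<epsilon> X2 *s ((\<epsilon> X1 * (\<epsilon> \<beta> * \<epsilon> \<alpha>)) *s (\<epsilon> X3 *s 1)))"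
    by (simp add: sum3_lin[of eps]) (simp add: eps_def counit_mult counit_antipode mult_ac)
  also have "\<dots> = (\<epsilon> 1 * (\<epsilon> \<beta> * \<epsilon> \<alpha>)) *s (\<epsilon> 1 *s 1)"
    by (rule counit_mid) (simp del: scale_scale)
  finally show ?thesis
    using one_neq_zero scale_right_imp_eq[of "1 :: 'h" 1 "\<epsilon> \<beta> * \<epsilon> \<alpha>"] by (simp add: eps_def counit_one)
qed

end

context quasitriangular_quasi_hopf_algebra
begin

section \<open>The Drinfeld element\<close>

declare R_closed [simp]

text \<open>The form \<open>V \<otimes> V\<^sup>* \<rightarrow> V\<^sup>* \<otimes> V \<rightarrow> k\<close>, the braiding followed by the evaluation.\<close>

definition braided_form :: 'h where
  "braided_form = sum2 R (\<lambda>a b. S b * \<alpha> * a)"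

text \<open>The counterpart \<open>V\<^sup>*\<^sup>* \<rightarrow> V\<close> of the Drinfeld element. Its form \<open>S(m)\<close> is the braided form of the module
  \<open>V\<^sup>*\<close>. For a ribbon algebra it turns out to be \<open>S(u)\<close>.\<close>

definition drinfeld_coelement :: 'h where
  "drinfeld_coelement = double_dual_comap (S braided_form)"

lemma R_intertwines_sum:
  assumes g: "ml2 g"
  shows "sum2 (\<Delta> h) (\<lambda>h1 h2. sum2 R (\<lambda>a b. g (h2 * a) (h1 * b))) =
      sum2 R (\<lambda>a b. sum2 (\<Delta> h) (\<lambda>h1 h2. g (a * h1) (b * h2)))"
proof -
  note [simp] = ml2_comp[OF g] multilinear_simps
  show ?thesis
    using arg_cong[OF R_intertwines, of "\<lambda>A. sum2 A g" h] g by (simp add: sum2_mult sum2_flip)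
qed

text \<open>The braiding is a module map, so \<open>R\<close> exchanges \<open>\<Delta>\<close> with its opposite, after which the antipode axiom for
  \<open>\<alpha>\<close> applies.\<close>

lemma braided_form_invariant: "sum2 (\<Delta> h) (\<lambda>a b. S b * braided_form * a) = \<epsilon> h *s braided_form"
proof -
  note [simp] = multilinear_simps
  define g where "g a b = S b * \<alpha> * a" for a b
  have g: "ml2 g" by (simp add: g_def)
  have "sum2 (\<Delta> h) (\<lambda>a b. S b * braided_form * a) = sum2 (\<Delta> h) (\<lambda>c d. sum2 R (\<lambda>a b. g (a * c) (b * d)))"
    by (simp add: braided_form_def sum2_lin[of "\<lambda>x. S _ * x * _"]) (simp add: g_def antipode_mult mult.assoc)
  also have "\<dots> = sum2 (\<Delta> h) (\<lambda>c d. sum2 R (\<lambda>a b. g (d * a) (c * b)))"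
    unfolding R_intertwines_sum[OF g] by (rule sum2_sum2_swap)
  also have "\<dots> = sum2 R (\<lambda>a b. sum2 (\<Delta> h) (\<lambda>c d. g (d * a) (c * b)))"
    by (rule sum2_sum2_swap)
  also have "\<dots> = sum2 R (\<lambda>a b. \<epsilon> h *s g a b)"
    using sum_comult_lin[OF antipode_left_sum, of "\<lambda>t. S _ * t * _"]
    by (simp add: g_def antipode_mult mult.assoc)
  also have "\<dots> = \<epsilon> h *s braided_form"
    by (simp add: braided_form_def g_def sum2_lin[of "\<lambda>x. _ *s x"])
  finally show ?thesis .
qed

lemma S_braided_form_invariant:
  "sum2 (\<Delta> h) (\<lambda>a b. S a * S braided_form * S (S b)) = \<epsilon> h *s S braided_form"
  using arg_cong[OF braided_form_invariant, of S h] lin_antipode[OF lin_id]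
  by (simp add: sum2_lin[of S] antipode_mult mult.assoc) (simp add: lin_def)

abbreviation \<u> :: 'h where "\<u> \<equiv> drinfeld_element \<Phi> S \<alpha> \<beta> R"
abbreviation \<w> :: 'h where "\<w> \<equiv> drinfeld_coelement"

lemma drinfeld_element_eq: "\<u> = double_dual_map braided_form"
proof -
  note [simp] = multilinear_simps
  have "\<u> = sum2 R (\<lambda>a b. sum3 \<psi> (\<lambda>x1 x2 x3. S (b * x2 * \<beta> * S x3) * \<alpha> * a * x1))"
    by (simp add: drinfeld_element_def sum2_def sum3_def)
  also have "\<dots> = sum3 \<psi> (\<lambda>x1 x2 x3. sum2 R (\<lambda>a b. S (b * x2 * \<beta> * S x3) * \<alpha> * a * x1))"
    by (rule sum2_sum3_swap)
  finally show ?thesis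
    by (simp add: double_dual_map_def braided_form_def sum2_lin[of "\<lambda>x. S _ * x * _"])
      (simp add: antipode_mult mult.assoc)
qed

lemma drinfeld_intertwines: "S (S h) * \<u> = \<u> * h"
  unfolding drinfeld_element_eq by (rule double_dual_map_intertwines[OF braided_form_invariant])

lemma antipode_alpha_drinfeld: "S \<alpha> * \<u> = braided_form"
  unfolding drinfeld_element_eq by (rule antipode_alpha_double_dual_map[OF braided_form_invariant])

lemma codrinfeld_intertwines: "h * \<w> = \<w> * S (S h)"
  unfolding drinfeld_coelement_def by (rule double_dual_comap_intertwines[OF S_braided_form_invariant])

lemma alpha_codrinfeld: "\<alpha> * \<w> = S braided_form"
  unfolding drinfeld_coelement_def by (rule alpha_double_dual_comap[OF S_braided_form_invariant])

lemma S_braided_form: "S braided_form = sum2 R (\<lambda>a b. S a * S \<alpha> * S (S b))"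
  unfolding braided_form_def
  by (simp add: sum2_lin[of S] lin_antipode lin_id antipode_mult mult.assoc)

lemma codrinfeld_drinfeld_central: "central (\<w> * \<u>)"
  unfolding central_def
  by (metis codrinfeld_intertwines drinfeld_intertwines mult.assoc)

section \<open>Ribbon elements\<close>

abbreviation monodromy where "monodromy \<equiv> tensor_flip R \<odot>\<^bsub>2\<^esub> R"

text \<open>Evaluation after two braidings. The first braiding turns \<open>\<alpha>\<close> into \<open>m = S(\<alpha>)u\<close>; moving \<open>u\<close> to the right past the
  second copy of \<open>R\<close> leaves \<open>S(R\<^sup>1)S(\<alpha>)S\<^sup>2(R\<^sup>2) = S(m)\<close>, which is \<open>\<alpha>w\<close>.\<close>

lemma double_braiding_form: "sum2 monodromy (\<lambda>a b. S a * \<alpha> * b) = \<alpha> * (\<w> * \<u>)"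
proof -
  note [simp] = multilinear_simps
  have "sum2 monodromy (\<lambda>a b. S a * \<alpha> * b)
      = sum2 R (\<lambda>a b. sum2 R (\<lambda>c d. S c * (S b * \<alpha> * a) * d))"
    by (simp add: sum2_mult sum2_flip antipode_mult mult.assoc)
  also have "\<dots> = sum2 R (\<lambda>c d. sum2 R (\<lambda>a b. S c * (S b * \<alpha> * a) * d))"
    by (rule sum2_sum2_swap)
  also have "\<dots> = sum2 R (\<lambda>c d. S c * (S \<alpha> * \<u>) * d)"
    by (simp add: antipode_alpha_drinfeld) (simp add: braided_form_def sum2_lin[of "\<lambda>x. S _ * x * _"])
  also have "\<dots> = sum2 R (\<lambda>c d. S c * S \<alpha> * S (S d) * \<u>)"
    by (simp add: mult.assoc drinfeld_intertwines)
  also have "\<dots> = S braided_form * \<u>"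
    by (simp add: S_braided_form sum2_lin[of "\<lambda>x. x * \<u>"])
  also have "\<dots> = \<alpha> * (\<w> * \<u>)"
    by (simp add: alpha_codrinfeld mult.assoc flip: mult.assoc[of \<alpha>])
  finally show ?thesis .
qed

text \<open>A central \<open>z\<close> can be inserted next to \<open>\<alpha>\<close> in \<open>X\<^sup>1\<beta>S(X\<^sup>2)\<alpha>X\<^sup>3 = 1\<close>, so it is a function of \<open>\<alpha>z\<close>.\<close>

lemma eq_if_alpha_mult_eq:
  assumes "central a" "central b" "\<alpha> * a = \<alpha> * b"
  shows "a = b"
proof -
  have "z = sum3 \<Phi> (\<lambda>X1 X2 X3. X1 * \<beta> * S X2 * (\<alpha> * z) * X3)" if "central z" for z
  proof -
    have "z = sum3 \<Phi> (\<lambda>X1 X2 X3. X1 * \<beta> * S X2 * \<alpha> * X3) * z"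
      by (simp add: antipode_reassociator_sum)
    also have "\<dots> = sum3 \<Phi> (\<lambda>X1 X2 X3. X1 * \<beta> * S X2 * \<alpha> * (X3 * z))"
      by (simp add: sum3_lin[of "\<lambda>x. x * z"] lin_intros mult.assoc)
    finally show ?thesis
      using that by (simp add: central_def mult.assoc)
  qed
  from this[OF assms(1)] this[OF assms(2)] assms(3) show ?thesis by simp
qed

lemma monodromy_inv:
  shows monodromy_closed: "monodromy \<in> tensor_power 2" "tensor_inv 2 monodromy \<in> tensor_power 2"
    and "tensor_inv 2 monodromy \<odot>\<^bsub>2\<^esub> monodromy = tensor_one 2"
  using tensor_invertibleD[OF _ tensor_invertible_flip_mult[OF R_closed R_invertible]] by simp_all

lemma comult_ribbon_monodromy:
  assumes "\<Delta> \<nu> = pure [\<nu>, \<nu>] \<odot>\<^bsub>2\<^esub> tensor_inv 2 monodromy"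
  shows "\<Delta> \<nu> \<odot>\<^bsub>2\<^esub> monodromy = pure [\<nu>, \<nu>]"
  using assms by (simp add: tensor_mult_assoc monodromy_inv pure_closed tensor_mult_one)

text \<open>Apply \<open>\<epsilon> \<otimes> id\<close> to \<open>\<Delta>(\<nu>)R\<^sub>2\<^sub>1R = \<nu> \<otimes> \<nu>\<close>; the counit removes both copies of \<open>R\<close>.\<close>

lemma ribbon_counit:
  assumes "\<Delta> \<nu> = pure [\<nu>, \<nu>] \<odot>\<^bsub>2\<^esub> tensor_inv 2 monodromy"
  shows "\<epsilon> \<nu> *s \<nu> = \<nu>"
proof -
  note [simp] = multilinear_simps
  have R: "sum2 R (\<lambda>c d. \<epsilon> c *s (h * d)) = h" "sum2 R (\<lambda>c d. \<epsilon> d *s (\<epsilon> c *s h)) = h" for h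
  proof -
    have *: "sum2 R (\<lambda>c d. \<epsilon> c *s d) = 1"
      using counit_R_left by (simp add: sum2_def)
    show "sum2 R (\<lambda>c d. \<epsilon> c *s (h * d)) = h"
      using sum2_lin[of "\<lambda>x. h * x" R "\<lambda>c d. \<epsilon> c *s d"] by (simp add: * scale_mult_right)
    show "sum2 R (\<lambda>c d. \<epsilon> d *s (\<epsilon> c *s h)) = h"
      using sum2_lin[of "\<lambda>x. \<epsilon> x *s h" R "\<lambda>c d. \<epsilon> c *s d"] counit_linear
      by (simp add: * counit_one Vector_Spaces.linear_iff mult.commute)
  qed
  have "\<epsilon> \<nu> *s \<nu> = sum2 (\<Delta> \<nu> \<odot>\<^bsub>2\<^esub> monodromy) (\<lambda>a b. \<epsilon> a *s b)"
    unfolding comult_ribbon_monodromy[OF assms] by (simp add: sum2_pure)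
  also have "\<dots> = sum2 (\<Delta> \<nu>) (\<lambda>a b. sum2 R (\<lambda>c d. sum2 R (\<lambda>c' d'. \<epsilon> a *s (\<epsilon> d *s (\<epsilon> c' *s (b * c * d'))))))"
    by (simp add: sum2_mult sum2_flip monodromy_closed counit_mult mult.assoc
        scale_scale[symmetric] del: scale_scale)
  also have "\<dots> = sum2 (\<Delta> \<nu>) (\<lambda>a b. sum2 R (\<lambda>c d. \<epsilon> a *s (\<epsilon> d *s (b * c))))"
    by (simp only: R sum2_lin[of "\<lambda>x. _ *s x", symmetric] multilinear_simps)
  also have "\<dots> = sum2 (\<Delta> \<nu>) (\<lambda>a b. \<epsilon> a *s (b * sum2 R (\<lambda>c d. \<epsilon> d *s c)))"
    by (simp add: sum2_lin[of "\<lambda>x. _ *s (_ * x)"] scale_mult_right)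
  also have "sum2 R (\<lambda>c d. \<epsilon> d *s c) = 1"
    using counit_R_right by (simp add: sum2_def)
  finally show ?thesis
    using sum_comult_counit_left[of "\<lambda>x. x"] by simp
qed

text \<open>Since \<open>R\<^sub>2\<^sub>1R = \<Delta>(\<nu>\<^sup>-\<^sup>1)(\<nu> \<otimes> \<nu>)\<close>, the sum equals \<open>S(\<nu>)S(\<nu>\<^sup>-\<^sup>1\<^sub>1)\<alpha>\<nu>\<^sup>-\<^sup>1\<^sub>2\<nu>\<close>,
  and the antipode axiom contributes the factor \<open>\<epsilon>(\<nu>\<^sup>-\<^sup>1)\<close>, which \<open>ribbon_counit\<close> removes.\<close>

lemma ribbon_square_alpha:
  assumes \<nu>: "central \<nu>" "\<nu> * \<mu> = 1" "S \<nu> = \<nu>"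
    and ribbon: "\<Delta> \<nu> = pure [\<nu>, \<nu>] \<odot>\<^bsub>2\<^esub> tensor_inv 2 monodromy"
  shows "sum2 monodromy (\<lambda>a b. S a * \<alpha> * b) = \<alpha> * (\<nu> * \<nu>)"
proof -
  note [simp] = multilinear_simps
  have \<mu>: "\<mu> * \<nu> = 1" using \<nu> by (simp add: central_def)
  have "\<Delta> \<mu> \<odot>\<^bsub>2\<^esub> pure [\<nu>, \<nu>] = \<Delta> \<mu> \<odot>\<^bsub>2\<^esub> \<Delta> \<nu> \<odot>\<^bsub>2\<^esub> monodromy"
    by (simp add: comult_ribbon_monodromy[OF ribbon, symmetric] tensor_mult_assoc monodromy_closed)
  also have "\<dots> = monodromy"
    by (simp add: \<mu> comult_one tensor_mult_one monodromy_closed flip: comult_mult)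
  finally have "sum2 monodromy (\<lambda>a b. S a * \<alpha> * b)
      = sum2 (\<Delta> \<mu> \<odot>\<^bsub>2\<^esub> pure [\<nu>, \<nu>]) (\<lambda>a b. S a * \<alpha> * b)"
    by (simp only:)
  also have "\<dots> = sum2 (\<Delta> \<mu>) (\<lambda>a b. S (a * \<nu>) * \<alpha> * (b * \<nu>))"
    by (simp add: sum2_mult sum2_pure pure_closed)
  also have "\<dots> = sum2 (\<Delta> \<mu>) (\<lambda>a b. \<nu> * (S a * \<alpha> * b) * \<nu>)"
    by (simp add: antipode_mult \<nu>(3) mult.assoc)
  also have "\<dots> = \<epsilon> \<mu> *s (\<nu> * \<alpha> * \<nu>)"
    by (rule sum_comult_lin[OF antipode_left_sum]) simp
  also have "\<nu> * \<alpha> * \<nu> = \<epsilon> \<nu> *s (\<nu> * \<alpha> * \<nu>)"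
    using ribbon_counit[OF ribbon] by (metis scale_mult_right)
  also have "\<epsilon> \<mu> *s \<epsilon> \<nu> *s (\<nu> * \<alpha> * \<nu>) = \<nu> * \<alpha> * \<nu>"
    by (simp add: counit_one \<mu> flip: counit_mult)
  finally show ?thesis
    using \<nu>(1) unfolding central_def by (metis mult.assoc)
qed

text \<open>A one-sided inverse is upgraded to a two-sided one by showing that the complementary idempotent
  \<open>P = 1 - \<nu>\<^sup>-\<^sup>2uw\<close> vanishes.\<close>

lemma drinfeld_codrinfeld:
  assumes \<nu>: "central \<nu>" "\<nu> * \<mu> = 1" and wu: "\<w> * \<u> = \<nu> * \<nu>"
  shows "\<u> * \<w> = \<nu> * \<nu>"
proof -
  note [simp] = multilinear_simps
  have comm: "\<nu> * x = x * \<nu>" for x using \<nu>(1) by (simp add: central_def)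
  have \<mu>: "\<mu> * \<nu> = 1" using \<nu>(2) comm by simp
  have comm': "\<mu> * x = x * \<mu>" for x
    by (metis \<nu>(2) \<mu> comm mult.assoc mult_1_left mult_1_right)
  define P where "P = 1 - \<u> * \<w> * (\<mu> * \<mu>)"
  have comm_P: "S (S h) * P = P * S (S h)" for h
  proof -
    have "S (S h) * (\<u> * \<w>) = (\<u> * \<w>) * S (S h)"
      by (metis codrinfeld_intertwines drinfeld_intertwines mult.assoc)
    then have "S (S h) * (\<u> * \<w> * (\<mu> * \<mu>)) = \<u> * \<w> * (\<mu> * \<mu>) * S (S h)"
      by (metis comm' mult.assoc)
    then show ?thesis by (simp add: P_def algebra_simps)
  qed
  have "\<w> * (\<u> * \<w> * (\<mu> * \<mu>)) = \<nu> * \<nu> * \<mu> * \<mu> * \<w>"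
    by (metis wu comm' mult.assoc)
  also have "\<dots> = \<w>"
    using \<nu>(2) by (metis mult.assoc mult_1_left mult_1_right)
  finally have "\<w> * P = 0" by (simp add: P_def right_diff_distrib)
  then have form_P: "S braided_form * P = 0"
    by (simp add: mult.assoc flip: alpha_codrinfeld)
  \<comment> \<open>\<open>S(m)\<close> is a sum over \<open>R\<close>; multiplying with \<open>R\<^sup>-\<^sup>1\<close> from both sides cancels \<open>R\<close>, since \<open>P\<close> lets \<open>S\<^sup>2\<close> pass.\<close>
  have alpha_P: "S \<alpha> * P = 0"
  proof -
    obtain B where B: "B \<in> tensor_power 2" "R \<odot>\<^bsub>2\<^esub> B = tensor_one 2"
      using R_invertible by (auto simp: tensor_invertible_def)
    have "S \<alpha> * P = sum2 (R \<odot>\<^bsub>2\<^esub> B) (\<lambda>a b. S a * S \<alpha> * S (S b) * P)"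
      by (simp add: B(2) sum2_one antipode_one)
    also have "\<dots> = sum2 R (\<lambda>a b. sum2 B (\<lambda>c d. S c * (S a * S \<alpha> * S (S b) * P) * S (S d)))"
      using B(1) by (simp add: sum2_mult antipode_mult mult.assoc comm_P)
    also have "\<dots> = sum2 B (\<lambda>c d. sum2 R (\<lambda>a b. S c * (S a * S \<alpha> * S (S b) * P) * S (S d)))"
      by (rule sum2_sum2_swap)
    also have "\<dots> = sum2 B (\<lambda>c d. S c * (S braided_form * P) * S (S d))"
      by (simp add: S_braided_form sum2_lin[of "\<lambda>x. S _ * (x * P) * S (S _)"])
    finally show ?thesis by (simp add: form_P sum_0)
  qed
  \<comment> \<open>Applying \<open>S\<close> to \<open>S(x\<^sup>1)\<alpha>x\<^sup>2\<beta>S(x\<^sup>3) = 1\<close> leaves only factors \<open>S\<^sup>2(x\<^sup>1)\<close> to the right of \<open>S(\<alpha>)\<close>.\<close>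
  have "P = S (sum3 \<psi> (\<lambda>x1 x2 x3. S x1 * \<alpha> * x2 * \<beta> * S x3)) * P"
    by (simp add: antipode_reassociator_inv_sum antipode_one)
  also have "\<dots> = sum3 \<psi> (\<lambda>x1 x2 x3. S (S x3) * S \<beta> * S x2 * (S \<alpha> * P) * S (S x1))"
    by (simp add: sum3_lin[of "\<lambda>x. S x * P"] antipode_mult mult.assoc comm_P)
  also have "\<dots> = 0" by (simp add: alpha_P sum_0)
  finally have "\<u> * \<w> * (\<mu> * \<mu>) = 1" by (simp add: P_def)
  then show ?thesis
    by (metis \<mu> mult.assoc mult_1_left mult_1_right)
qed

text \<open>Both products of \<open>u\<close> and \<open>w\<close> are \<open>\<nu>\<^sup>2\<close>, so only \<open>w = S(u)\<close> remains. This uses \<open>xS(u) = S(u)S\<^sup>2(x)\<close>, which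
  follows from the intertwining property of \<open>u\<close> for \<open>x\<close> in the image of \<open>S\<close>, hence for all \<open>x\<close>, as \<open>S\<^sup>2\<close> is
  conjugation by the invertible \<open>u\<close>.\<close>

lemma ribbon_imp_square:
  assumes \<nu>: "central \<nu>" "\<nu> * \<mu> = 1" "S \<nu> = \<nu>"
    and ribbon: "\<Delta> \<nu> = pure [\<nu>, \<nu>] \<odot>\<^bsub>2\<^esub> tensor_inv 2 monodromy"
  shows "\<nu> * \<nu> = \<u> * S \<u>"
proof -
  note [simp] = multilinear_simps
  have comm: "\<nu> * x = x * \<nu>" for x using \<nu>(1) by (simp add: central_def)
  have wu: "\<w> * \<u> = \<nu> * \<nu>"
  proof (rule eq_if_alpha_mult_eq[OF codrinfeld_drinfeld_central])
    show "central (\<nu> * \<nu>)" unfolding central_def by (metis comm mult.assoc)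
    show "\<alpha> * (\<w> * \<u>) = \<alpha> * (\<nu> * \<nu>)"
      using ribbon_square_alpha[OF assms] double_braiding_form by simp
  qed
  have uw: "\<u> * \<w> = \<nu> * \<nu>"
    by (rule drinfeld_codrinfeld[OF \<nu>(1,2) wu])
  have cancel: "x = y" if "x * (\<nu> * \<nu>) = y * (\<nu> * \<nu>)" for x y
    using that \<nu>(2) by (metis mult.assoc mult_1_right)
  \<comment> \<open>The preimage of \<open>x\<close> under \<open>S\<^sup>2\<close> is \<open>\<nu>\<^sup>-\<^sup>2wxu = u\<^sup>-\<^sup>1xu\<close>.\<close>
  have surj: "\<exists>y. x = S y" for x
  proof -
    have "S (S (\<w> * x * \<u>)) * (\<u> * \<w>) = \<u> * (\<w> * x * \<u>) * \<w>"
      by (metis drinfeld_intertwines mult.assoc)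
    also have "\<dots> = x * (\<nu> * \<nu>) * (\<nu> * \<nu>)"
      by (metis uw comm mult.assoc)
    finally have eq: "S (S (\<w> * x * \<u>)) = x * (\<nu> * \<nu>)"
      unfolding uw by (rule cancel)
    have "S (\<mu> * \<mu> * S (\<w> * x * \<u>)) = x * \<nu> * \<nu> * S \<mu> * S \<mu>"
      unfolding antipode_mult[of "\<mu> * \<mu>"] eq by (simp add: antipode_mult mult.assoc)
    moreover have "\<nu> * S \<mu> = 1"
      using \<nu> comm by (metis antipode_mult antipode_one)
    ultimately have "S (\<mu> * \<mu> * S (\<w> * x * \<u>)) = x"
      by (metis mult.assoc mult_1_right)
    then show ?thesis by metis
  qed
  have Su: "x * S \<u> = S \<u> * S (S x)" for x
  proof -
    obtain y where "x = S y" using surj by blast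
    then show ?thesis
      using drinfeld_intertwines[of y] by (metis antipode_mult)
  qed
  have "\<w> = sum3 \<Phi> (\<lambda>X1 X2 X3. X1 * \<beta> * S X2 * (S \<u> * S (S \<alpha>)) * S (S X3))"
    by (simp add: drinfeld_coelement_def double_dual_comap_def antipode_mult
        flip: antipode_alpha_drinfeld)
  also have "\<dots> = sum3 \<Phi> (\<lambda>X1 X2 X3. S \<u> * S (S (X1 * \<beta> * S X2 * \<alpha> * X3)))"
    using Su by (simp add: antipode_mult) (metis mult.assoc)
  also have "\<dots> = S \<u> * S (S (sum3 \<Phi> (\<lambda>X1 X2 X3. X1 * \<beta> * S X2 * \<alpha> * X3)))"
    by (simp add: sum3_lin[of "\<lambda>x. S \<u> * S (S x)"])
  finally have "\<w> = S \<u>"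
    by (simp add: antipode_reassociator_sum antipode_one)
  with uw show ?thesis by simp
qed

text \<open>Under \<open>\<epsilon>\<close> both \<open>R\<close> and \<open>\<Phi>\<^sup>-\<^sup>1\<close> become \<open>1\<close> and \<open>\<epsilon> \<circ> S = \<epsilon>\<close>, so \<open>\<epsilon>(u) = \<epsilon>(\<beta>)\<epsilon>(\<alpha>) = 1\<close>.\<close>

lemma counit_drinfeld: "\<epsilon> \<u> = 1"
proof -
  note [simp] = multilinear_simps lin_eps
  have "eps braided_form = sum2 R (\<lambda>a b. \<epsilon> \<alpha> *s eps (\<epsilon> a *s b))"
    using counit_linear
    by (simp add: braided_form_def sum2_lin[of eps])
      (simp add: eps_def counit_mult counit_antipode Vector_Spaces.linear_iff mult_ac)
  also have "\<dots> = \<epsilon> \<alpha> *s eps (sum2 R (\<lambda>a b. \<epsilon> a *s b))"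
    by (simp only: sum2_lin[of "\<lambda>x. _ *s eps x"] multilinear_simps lin_eps)
  also have "sum2 R (\<lambda>a b. \<epsilon> a *s b) = 1"
    using counit_R_left by (simp add: sum2_def)
  also have "\<epsilon> \<alpha> *s eps 1 = eps \<alpha>"
    by (simp add: eps_def counit_one)
  finally have form: "\<epsilon> braided_form = \<epsilon> \<alpha>" by (simp add: eps_inject)
  have "eps \<u> = sum3 \<psi> (\<lambda>x1 x2 x3. \<epsilon> x2 *s ((\<epsilon> x1 * (\<epsilon> \<beta> * \<epsilon> \<alpha>)) *s (\<epsilon> x3 *s 1)))"
    by (simp add: drinfeld_element_eq double_dual_map_def sum3_lin[of eps])
      (simp add: eps_def counit_mult counit_antipode form mult_ac)
  also have "\<dots> = (\<epsilon> 1 * (\<epsilon> \<beta> * \<epsilon> \<alpha>)) *s (\<epsilon> 1 *s 1)"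
    by (rule counit_mid_inv) (simp del: scale_scale)
  also have "\<dots> = eps 1"
    by (simp add: eps_def counit_one counit_beta_alpha)
  finally show ?thesis by (simp add: eps_inject counit_one)
qed

text \<open>With \<open>\<epsilon>(\<nu>) = 1\<close> the antipode axiom for \<open>\<Delta>(\<nu>)\<close> reads \<open>\<alpha> = \<nu>\<^sup>2t\<close>, where \<open>t\<close> is the value of
  \<open>a \<otimes> b \<mapsto> S(a)\<alpha>b\<close> on \<open>(R\<^sub>2\<^sub>1R)\<^sup>-\<^sup>1\<close>. One factor \<open>\<nu>\<close> can be pulled out of \<open>X\<^sup>1\<beta>S(X\<^sup>2)\<alpha>X\<^sup>3 = 1\<close>; the
  rest is the inverse \<open>\<mu>\<close>.\<close>

lemma square_imp_invertible:
  assumes \<nu>: "central \<nu>" "S \<nu> = \<nu>" "\<nu> * \<nu> = \<u> * S \<u>"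
    and ribbon: "\<Delta> \<nu> = pure [\<nu>, \<nu>] \<odot>\<^bsub>2\<^esub> tensor_inv 2 monodromy"
  shows "\<exists>\<mu>. \<nu> * \<mu> = 1 \<and> \<mu> * \<nu> = 1"
proof -
  note [simp] = multilinear_simps
  have comm: "\<nu> * x = x * \<nu>" for x using \<nu>(1) by (simp add: central_def)
  have "\<epsilon> \<nu> * \<epsilon> \<nu> = 1"
    using arg_cong[OF \<nu>(3), of \<epsilon>] by (simp add: counit_mult counit_antipode counit_drinfeld)
  moreover have "\<epsilon> \<nu> * \<epsilon> \<nu> = \<epsilon> \<nu>"
    using arg_cong[OF ribbon_counit[OF ribbon], of \<epsilon>] counit_linear
    by (simp add: Vector_Spaces.linear_iff)
  ultimately have eps: "\<epsilon> \<nu> = 1" by simp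
  let ?T = "tensor_inv 2 monodromy"
  define t where "t = sum2 ?T (\<lambda>a b. S a * \<alpha> * b)"
  have "\<alpha> = sum2 (\<Delta> \<nu>) (\<lambda>a b. S a * \<alpha> * b)"
    by (simp add: antipode_left_sum eps)
  also have "\<dots> = sum2 ?T (\<lambda>a b. S (\<nu> * a) * \<alpha> * (\<nu> * b))"
    unfolding ribbon by (simp add: sum2_mult sum2_pure monodromy_closed pure_closed)
  also have "\<dots> = sum2 ?T (\<lambda>a b. \<nu> * \<nu> * (S a * \<alpha> * b))"
  proof -
    have "S (\<nu> * a) * \<alpha> * (\<nu> * b) = \<nu> * \<nu> * (S a * \<alpha> * b)" for a b
    proof -
      have "S (\<nu> * a) * \<alpha> * (\<nu> * b) = (S a * \<nu>) * ((\<alpha> * \<nu>) * b)"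
        by (simp add: antipode_mult \<nu>(2) mult.assoc)
      also have "\<dots> = (\<nu> * S a) * ((\<nu> * \<alpha>) * b)"
        by (simp only: comm)
      also have "\<dots> = \<nu> * ((S a * \<nu>) * (\<alpha> * b))"
        by (simp only: mult.assoc)
      also have "\<dots> = \<nu> * ((\<nu> * S a) * (\<alpha> * b))"
        by (simp only: comm)
      finally show ?thesis by (simp only: mult.assoc)
    qed
    then show ?thesis by simp
  qed
  also have "\<dots> = \<nu> * \<nu> * t"
    by (simp add: t_def sum2_lin[of "\<lambda>x. \<nu> * \<nu> * x"])
  finally have \<alpha>: "\<alpha> = \<nu> * (\<nu> * t)" by (simp add: mult.assoc)
  define \<mu> where "\<mu> = sum3 \<Phi> (\<lambda>X1 X2 X3. X1 * \<beta> * S X2 * (\<nu> * t) * X3)"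
  have "\<nu> * \<mu> = sum3 \<Phi> (\<lambda>X1 X2 X3. X1 * \<beta> * S X2 * (\<nu> * (\<nu> * t)) * X3)"
  proof -
    have "\<nu> * (p * q * r) = p * (\<nu> * q) * r" for p q r
      by (metis comm mult.assoc)
    then show ?thesis
      by (simp only: \<mu>_def sum3_lin[of "\<lambda>x. \<nu> * x"] multilinear_simps)
  qed
  then have "\<nu> * \<mu> = 1"
    unfolding \<alpha>[symmetric] by (simp add: antipode_reassociator_sum)
  with comm show ?thesis by metis
qed

end

theorem theorem3p1:
  fixes scale :: "'k::field \<Rightarrow> 'h::ring_1 \<Rightarrow> 'h"
    and \<Delta> :: "'h \<Rightarrow> ('k, 'h) tensor"
    and \<epsilon> :: "'h \<Rightarrow> 'k"
    and \<Phi> R :: "('k, 'h) tensor"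
    and S :: "'h \<Rightarrow> 'h"
    and \<alpha> \<beta> u :: 'h
  assumes "quasitriangular_quasi_hopf_algebra scale \<Delta> \<epsilon> \<Phi> S \<alpha> \<beta> R"
    and "u = k_algebra.drinfeld_element scale \<Phi> S \<alpha> \<beta> R"
  shows "ribbon_quasi_hopf_algebra scale \<Delta> \<epsilon> \<Phi> S \<alpha> \<beta> R \<longleftrightarrow>
    (\<exists>\<nu>. central \<nu> \<and>
       \<Delta> \<nu> = k_algebra.tensor_mult scale 2 (k_algebra.pure scale [\<nu>, \<nu>])
                (k_algebra.tensor_inv scale 2
                   (k_algebra.tensor_mult scale 2 (k_algebra.tensor_flip scale R) R)) \<and>
       S \<nu> = \<nu> \<and>
       \<nu> ^ 2 = u * S u)"
proof -
  interpret quasitriangular_quasi_hopf_algebra scale \<Delta> \<epsilon> \<Phi> S \<alpha> \<beta> R by (rule assms(1))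
  have "ribbon_quasi_hopf_algebra scale \<Delta> \<epsilon> \<Phi> S \<alpha> \<beta> R \<longleftrightarrow>
      (\<exists>\<nu>. central \<nu> \<and> (\<exists>\<mu>. \<nu> * \<mu> = 1 \<and> \<mu> * \<nu> = 1) \<and>
         \<Delta> \<nu> = pure [\<nu>, \<nu>] \<odot>\<^bsub>2\<^esub> tensor_inv 2 monodromy \<and> S \<nu> = \<nu>)"
    using assms(1)
    by (simp add: ribbon_quasi_hopf_algebra_def ribbon_quasi_hopf_algebra_axioms_def)
  then show ?thesis
    unfolding assms(2) power2_eq_square
    using ribbon_imp_square square_imp_invertible by metis
qed

end
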